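(* Let $D=(0,1)$. Let $\chi_1,\chi_2$ be real-valued functions on $D$ with $M:=\|\chi_1\|_{L^\infty}+\|\chi_2\|_{L^\infty}<\infty$ and $\chi_2(x)>0$ for a.e. $x\in D$, and let $q\in C^1[0,1]$ be real-valued with $Q:=\|q\|_{L^\infty}>0$. There exists a constant $c_Q(\chi_2)>0$, depending only on $Q$ and $\chi_2$ (in particular not on $\chi_1$, $\omega$ or $\bm{u}$), such that if $\bm{u}\in X$ and $\omega\in\mathbb{C}$ satisfy $$\bm{u}\neq 0 \qquad\text{and}\qquad 0<|\omega|^2\le \frac{c_Q(\chi_2)}{M\,(1+M\|\bm{u}\|_X)},$$ then $T_\omega(\bm{u})\neq 0$.
   Context: All functions in $L^2=L^2(0,1)$ and $H^2=H^2(0,1)$ are complex-valued. $H^2$ carries the inner product $\langle u,v\rangle_{H^2}=\langle u,v\rangle_{L^2}+\langle u'',v''\rangle_{L^2}$ (its norm is equivalent to the standard one). $X=H^2\times L^2$, with elements $\bm{u}=(u_1,u_2)$, inner product $\langle\bm{u},\bm{\phi}\rangle_X=\langle u_1,\phi_1\rangle_{H^2}+\langle u_2,\phi_2\rangle_{L^2}$ and induced norm $\|\cdot\|_X$. For $\omega\in\mathbb{C}$, the (nonlinear) operator $T_\omega:X\to X$ is defined via the Riesz representation theorem by requiring, for all $\bm{u},\bm{\phi}\in X$, $$\langle T_\omega(\bm{u}),\bm{\phi}\rangle_X=\int_0^1\left[(u_1''+\omega^2 q u_1)\overline{\phi}_2+\omega^2\chi_1u_2\overline{u}_1\overline{\phi}_2\right]dx+\int_0^1\left[u_2(\overline{\phi}_1''+4\omega^2q\overline{\phi}_1)+\omega^2\chi_2u_1^2\overline{\phi}_1\right]dx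 .$$ *)

theory Defs
  imports "HOL-Analysis.Analysis" "HOL-Probability.Essential_Supremum"
begin

text \<open>
  Elements of Lebesgue and Sobolev spaces on the interval \<open>(0,1)\<close> are represented by functions
  on the real line, of which only the values on \<open>(0,1)\<close>, up to null sets, matter. Accordingly,
  ``is zero'' means ``vanishes almost everywhere on \<open>(0,1)\<close>''.
\<close>

abbreviation leb01 :: "real measure" where
  "leb01 \<equiv> lebesgue_on {0<..<1}"

definition Linf :: "(real \<Rightarrow> real) set" where
  "Linf = {f. f \<in> borel_measurable leb01 \<and> esssup leb01 (\<lambda>x. ereal \<bar>f x\<bar>) < \<infinity>}"

definition Linf_norm :: "(real \<Rightarrow> real) \<Rightarrow> real" where
  "Linf_norm f = real_of_ereal (esssup leb01 (\<lambda>x. ereal \<bar>f x\<bar>))"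

definition L2 :: "(real \<Rightarrow> complex) set" where
  "L2 = {f. f \<in> borel_measurable leb01 \<and> integrable leb01 (\<lambda>x. (cmod (f x))\<^sup>2)}"

definition L2_inner :: "(real \<Rightarrow> complex) \<Rightarrow> (real \<Rightarrow> complex) \<Rightarrow> complex" where
  "L2_inner f g = (LINT x|leb01. f x * cnj (g x))"

text \<open>
  One-dimensional Sobolev spaces are defined through weak derivatives, tested against \<open>C\<^sup>1\<close>
  functions with compact support in \<open>(0,1)\<close> (as in Brezis' textbook); real-valued test functions
  suffice by linearity.
\<close>

definition test_function :: "(real \<Rightarrow> real) \<Rightarrow> bool" where
  "test_function \<phi> \<longleftrightarrow> \<phi> C1_differentiable_on UNIV \<and>
     (\<exists>K. compact K \<and> K \<subseteq> {0<..<1} \<and> (\<forall>x. x \<notin> K \<longrightarrow> \<phi> x = 0))"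

definition is_weak_deriv :: "(real \<Rightarrow> complex) \<Rightarrow> (real \<Rightarrow> complex) \<Rightarrow> bool" where
  "is_weak_deriv u v \<longleftrightarrow> (\<forall>\<phi>. test_function \<phi> \<longrightarrow>
     (LINT x|leb01. u x * complex_of_real (deriv \<phi> x)) =
     - (LINT x|leb01. v x * complex_of_real (\<phi> x)))"

definition H1 :: "(real \<Rightarrow> complex) set" where
  "H1 = {u \<in> L2. \<exists>v\<in>L2. is_weak_deriv u v}"

text \<open>A representative of the weak derivative, which is unique up to null sets.\<close>

definition weak_deriv :: "(real \<Rightarrow> complex) \<Rightarrow> real \<Rightarrow> complex" where
  "weak_deriv u = (SOME v. v \<in> L2 \<and> is_weak_deriv u v)"

definition H2 :: "(real \<Rightarrow> complex) set" where
  "H2 = {u \<in> H1. weak_deriv u \<in> H1}"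

abbreviation weak_deriv2 :: "(real \<Rightarrow> complex) \<Rightarrow> real \<Rightarrow> complex" where
  "weak_deriv2 u \<equiv> weak_deriv (weak_deriv u)"

definition H2_inner :: "(real \<Rightarrow> complex) \<Rightarrow> (real \<Rightarrow> complex) \<Rightarrow> complex" where
  "H2_inner u v = L2_inner u v + L2_inner (weak_deriv2 u) (weak_deriv2 v)"

type_synonym fpair = "(real \<Rightarrow> complex) \<times> (real \<Rightarrow> complex)"

definition X :: "fpair set" where
  "X = H2 \<times> L2"

definition X_inner :: "fpair \<Rightarrow> fpair \<Rightarrow> complex" where
  "X_inner u \<phi> = H2_inner (fst u) (fst \<phi>) + L2_inner (snd u) (snd \<phi>)"

definition X_norm :: "fpair \<Rightarrow> real" where
  "X_norm u = sqrt (Re (X_inner u u))"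

definition X_zero :: "fpair \<Rightarrow> bool" where
  "X_zero u \<longleftrightarrow> (AE x in leb01. fst u x = 0) \<and> (AE x in leb01. snd u x = 0)"

definition T_form :: "(real \<Rightarrow> real) \<Rightarrow> (real \<Rightarrow> real) \<Rightarrow> (real \<Rightarrow> real) \<Rightarrow> complex \<Rightarrow>
    fpair \<Rightarrow> fpair \<Rightarrow> complex" where
  "T_form \<chi>1 \<chi>2 q \<omega> = (\<lambda>(u1, u2) (\<phi>1, \<phi>2).
     (LINT x|leb01.
        (weak_deriv2 u1 x + \<omega>\<^sup>2 * complex_of_real (q x) * u1 x) * cnj (\<phi>2 x)
        + \<omega>\<^sup>2 * complex_of_real (\<chi>1 x) * u2 x * cnj (u1 x) * cnj (\<phi>2 x))
     + (LINT x|leb01.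
        u2 x * (cnj (weak_deriv2 \<phi>1 x) + 4 * \<omega>\<^sup>2 * complex_of_real (q x) * cnj (\<phi>1 x))
        + \<omega>\<^sup>2 * complex_of_real (\<chi>2 x) * (u1 x)\<^sup>2 * cnj (\<phi>1 x)))"

text \<open>
  The Riesz representative of the bounded antilinear functional \<open>\<phi> \<mapsto> T_form \<chi>1 \<chi>2 q \<omega> u \<phi>\<close>. It
  is unique as an element of \<open>X\<close>, that is, up to null sets; the choice operator only selects a
  representative.
\<close>

definition T_op :: "(real \<Rightarrow> real) \<Rightarrow> (real \<Rightarrow> real) \<Rightarrow> (real \<Rightarrow> real) \<Rightarrow> complex \<Rightarrow>
    fpair \<Rightarrow> fpair" where
  "T_op \<chi>1 \<chi>2 q \<omega> u =
     (SOME w. w \<in> X \<and> (\<forall>\<phi>\<in>X. X_inner w \<phi> = T_form \<chi>1 \<chi>2 q \<omega> u \<phi>))"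

text \<open>
  \<open>C\<^sup>1[0,1]\<close>, with one-sided derivatives at the endpoints, so that values outside \<open>[0,1]\<close> are
  irrelevant (unlike for \<^const>\<open>C1_differentiable_on\<close>).
\<close>

definition C1_unit :: "(real \<Rightarrow> real) set" where
  "C1_unit = {q. \<exists>q'. continuous_on {0..1} q' \<and>
     (\<forall>x\<in>{0..1}. (q has_real_derivative q' x) (at x within {0..1}))}"

end

theory Submission
  imports Defs "HOL-Probability.Probability"
begin

text \<open>
  Suppose \<open>T\<^sub>\<omega>(u) = 0\<close> and put \<open>k = |\<omega>|\<^sup>2\<close>. Testing with \<open>(0, \<phi>\<^sub>2)\<close> gives the equation for \<open>u\<^sub>1\<close> pointwise;
  testing with \<open>(\<phi>\<^sub>1, 0)\<close>, where \<open>\<phi>\<^sub>1\<close> is free at the boundary, gives \<open>u\<^sub>2'' + 4\<omega>\<^sup>2qu\<^sub>2 + \<omega>\<^sup>2\<chi>\<^sub>2u\<^sub>1\<^sup>2 = 0\<close>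
  with zero Cauchy data at both end points. Hence \<open>u\<^sub>2\<close> is of size \<open>k \<parallel>\<chi>\<^sub>2\<parallel> S\<^sup>2\<close>, where \<open>S\<close> bounds \<open>|u\<^sub>1|\<close>, and
  \<open>u\<^sub>1\<close> differs little from an affine function \<open>a + bx\<close>. The test functions \<open>1\<close> and \<open>x\<close> show that
  \<open>\<integral> \<chi>\<^sub>2 u\<^sub>1\<^sup>2\<close> and \<open>\<integral> \<chi>\<^sub>2 u\<^sub>1\<^sup>2 x\<close> are small compared with \<open>S\<^sup>2\<close>. But for an affine function these two numbers
  cannot both be small: \<open>\<chi>\<^sub>2 > 0\<close> and compactness give a lower bound \<open>c\<^sub>0 (|a| + |b|)\<^sup>2\<close>. So \<open>S = 0\<close>.

  That \<open>T\<^sub>\<omega>\<close> is well defined is proved without Hilbert space theory: an element of \<open>H\<^sup>2\<close> is a double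
  primitive of its second weak derivative, and the Riesz representative is obtained from Banach's
  fixed point theorem.
\<close>

section \<open>Primitives of integrable functions on the unit interval\<close>

text \<open>Two moments are needed because \<open>u1\<close> is complex: the integral of
  \<open>\<chi>2 * u1^2\<close> alone can vanish for a nonzero affine function, as a binary
  quadratic form always has complex zeros. With N the norm of \<open>u\<close>, the threshold yields
  k M <= c for the linear terms and k M^2 N <= c for the product of \<open>\<chi>1\<close>,
  \<open>u2\<close> and \<open>cnj u1\<close>: there \<open>u2\<close> of size k M S^2 contributes
  (k M S)^2 S, and S is at most 57 N. The final inequality is homogeneous in S and closes as c0 S^2
  <= (c0/2) S^2. The regularity obstacle is that \<open>u2\<close> is only in L2 and that weak
  derivatives are arbitrary representatives. Hence \<open>u2\<close> is never differentiated:
  primitives from the left (\<open>prim\<close>) and from the right (\<open>coprim\<close>) are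
  transposes by Fubini, which replaces integration by parts and boundary traces. \<open>T_op\<close>
  is itself a choice, so its defining identity is available only once a representative has been
  constructed. This is a fourth-order problem whose integrated form contracts because four
  primitives have norm at most 1/6 and the affine projection costs a factor of at most 4.\<close>

lemma sets_leb01: "A \<in> sets borel \<Longrightarrow> A \<inter> {0<..<1} \<in> sets leb01"
  by (auto simp: sets_restrict_space)

text \<open>Total mass 1 makes the L1 norm at most the L2 norm and the supremum, so the estimates
  carry no length factors.\<close>

interpretation leb01: prob_space leb01
  by (rule prob_spaceI) (simp add: space_restrict_space emeasure_restrict_space)

interpretation leb01_pair: pair_sigma_finite leb01 leb01 ..

lemma borel_measurable_leb01: "f \<in> borel_measurable borel \<Longrightarrow> f \<in> borel_measurable leb01"
  by (simp add: borel_measurable_if_D measurable_completion measurable_restrict_space1)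

lemma id_leb01: "(\<lambda>x. x) \<in> leb01 \<rightarrow>\<^sub>M borel"
  by (simp add: borel_measurable_leb01)

text \<open>A Lebesgue integral with a cut-off rather than an interval integral: dominated
  convergence and Fubini on \<open>leb01\<close> apply directly, and for integrable \<open>v\<close>
  the result is bounded and continuous on the whole line.\<close>

definition prim :: "(real \<Rightarrow> complex) \<Rightarrow> real \<Rightarrow> complex" where
  "prim v x = (LINT t|leb01. indicator {..<x} t *\<^sub>R v t)"

text \<open>The primitive of \<open>- v\<close> that vanishes at 1; it serves as the transpose of
  \<open>prim\<close>, see \<open>prim_swap\<close>.\<close>

definition coprim :: "(real \<Rightarrow> complex) \<Rightarrow> real \<Rightarrow> complex" where
  "coprim v x = (LINT t|leb01. indicator {x<..} t *\<^sub>R v t)"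

lemma integrable_cut:
  fixes v :: "real \<Rightarrow> complex"
  assumes "integrable leb01 v" "A \<in> sets borel"
  shows "integrable leb01 (\<lambda>t. indicator A t *\<^sub>R v t)"
proof (rule Bochner_Integration.integrable_bound[OF assms(1)])
  have "(indicator A :: real \<Rightarrow> real) \<in> borel_measurable leb01"
    using assms(2) by (intro borel_measurable_leb01) simp
  then show "(\<lambda>t. indicator A t *\<^sub>R v t) \<in> borel_measurable leb01"
    using assms(1) by measurable
qed (auto simp: indicator_def)

lemma norm_prim_le:
  assumes "integrable leb01 v"
  shows "cmod (prim v x) \<le> (LINT t|leb01. cmod (v t))"
  unfolding prim_def
  using assms by (intro order_trans[OF integral_norm_bound integral_mono] integrable_cut integrable_norm)
    (auto simp: indicator_def)

lemma norm_coprim_le: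
  assumes "integrable leb01 v"
  shows "cmod (coprim v x) \<le> (LINT t|leb01. cmod (v t))"
  unfolding coprim_def
  using assms by (intro order_trans[OF integral_norm_bound integral_mono] integrable_cut integrable_norm)
    (auto simp: indicator_def)

lemma AE_leb01_neq: "AE t in leb01. t \<noteq> x"
proof (cases "x \<in> {0<..<1}")
  case True
  then have "{x} \<in> null_sets leb01"
    by (auto simp: null_sets_restrict_space)
  then show ?thesis
    by (rule AE_I') auto
qed (auto intro!: AE_I2)

lemma AE_leb01_mem: "AE t in leb01. t \<in> {0<..<1}"
  by (auto intro!: AE_I2)

lemma coprim_eq:
  assumes v: "integrable leb01 v"
  shows "coprim v x = (LINT t|leb01. v t) - prim v x"
proof -
  have "(LINT t|leb01. v t) = (LINT t|leb01. indicator {x<..} t *\<^sub>R v t + indicator {..<x} t *\<^sub>R v t)"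
  proof (rule integral_cong_AE)
    show "AE t in leb01. v t = indicator {x<..} t *\<^sub>R v t + indicator {..<x} t *\<^sub>R v t"
      using AE_leb01_neq[of x] by eventually_elim (auto simp: indicator_def)
  qed (use v integrable_cut[OF v, of "{x<..}"] integrable_cut[OF v, of "{..<x}"] in auto)
  then show ?thesis
    using v by (simp add: coprim_def prim_def integrable_cut)
qed

lemma continuous_prim:
  assumes v: "integrable leb01 v"
  shows "continuous_on UNIV (prim v)"
proof -
  have "(\<lambda>n. prim v (s n)) \<longlonglongrightarrow> prim v x" if s: "s \<longlonglongrightarrow> x" for s x
    unfolding prim_def
  proof (rule integral_dominated_convergence)
    show "integrable leb01 (\<lambda>t. cmod (v t))" using v by simp
    show "AE t in leb01. (\<lambda>n. indicator {..<s n} t *\<^sub>R v t) \<longlonglongrightarrow> indicator {..<x} t *\<^sub>R v t"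
      using AE_leb01_neq[of x]
    proof eventually_elim
      case (elim t)
      have "\<forall>\<^sub>F n in sequentially. (t < s n) = (t < x)"
      proof (cases "t < x")
        case True
        then show ?thesis using order_tendstoD(1)[OF s True] by (auto elim: eventually_mono)
      next
        case False
        then have "x < t" using elim by auto
        then show ?thesis using order_tendstoD(2)[OF s \<open>x < t\<close>] by (auto elim!: eventually_mono)
      qed
      then show ?case
        by (intro tendsto_eventually) (auto elim!: eventually_mono simp: indicator_def)
    qed
    show "AE t in leb01. cmod (indicator {..<s n} t *\<^sub>R v t) \<le> cmod (v t)" for n
      by (auto simp: indicator_def)
  qed (intro borel_measurable_integrable integrable_cut v; simp)+
  then show ?thesis
    by (auto simp: continuous_on_eq_continuous_at continuous_at_sequentially o_def)
qed

lemma measurable_prim: "integrable leb01 v \<Longrightarrow> prim v \<in> borel_measurable leb01"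
  by (intro borel_measurable_leb01 borel_measurable_continuous_onI continuous_prim)

lemma integrable_bounded_mult:
  fixes f g :: "real \<Rightarrow> complex"
  assumes "integrable leb01 f" "g \<in> borel_measurable leb01" "AE x in leb01. cmod (g x) \<le> B"
  shows "integrable leb01 (\<lambda>x. f x * g x)"
proof (rule Bochner_Integration.integrable_bound)
  show "integrable leb01 (\<lambda>x. B * cmod (f x))" using assms by simp
  show "AE x in leb01. cmod (f x * g x) \<le> norm (B * cmod (f x))"
    using assms(3)
  proof eventually_elim
    case (elim x)
    then have "cmod (f x) * cmod (g x) \<le> cmod (f x) * B" by (intro mult_left_mono) auto
    then show ?case by (simp add: norm_mult mult.commute)
  qed
qed (use assms in auto)

lemma integrable_prim: assumes "integrable leb01 v" shows "integrable leb01 (prim v)"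
  using assms measurable_prim norm_prim_le[OF assms]
  by (intro leb01.integrable_const_bound[where B="LINT t|leb01. cmod (v t)"]) auto

text \<open>Fubini on the triangle t < x. This is integration by parts without boundary terms, for
  functions that are merely integrable.\<close>

lemma prim_swap:
  assumes f: "integrable leb01 f" and g: "integrable leb01 g"
  shows "(LINT x|leb01. f x * prim g x) = (LINT t|leb01. coprim f t * g t)"
proof -
  let ?h = "\<lambda>(x, t). indicator {..<x} t *\<^sub>R (f x * g t)"
  have fm: "(\<lambda>z. f (fst z)) \<in> borel_measurable (leb01 \<Otimes>\<^sub>M leb01)"
    using f by (intro measurable_compose[OF measurable_fst]) auto
  have gm: "(\<lambda>z. g (snd z)) \<in> borel_measurable (leb01 \<Otimes>\<^sub>M leb01)"
    using g by (intro measurable_compose[OF measurable_snd]) auto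
  \<comment> \<open>Joint measurability is easier to see when the indicator becomes a comparison of
    the two projections.\<close>
  have eq: "?h = (\<lambda>z. if snd z < fst z then f (fst z) * g (snd z) else 0)"
    by (auto simp: indicator_def)
  have m1: "(\<lambda>z. fst z) \<in> borel_measurable (leb01 \<Otimes>\<^sub>M leb01)"
    by (rule measurable_compose[OF measurable_fst id_leb01])
  have m2: "(\<lambda>z. snd z) \<in> borel_measurable (leb01 \<Otimes>\<^sub>M leb01)"
    by (rule measurable_compose[OF measurable_snd id_leb01])
  have meas: "?h \<in> borel_measurable (leb01 \<Otimes>\<^sub>M leb01)"
    unfolding eq by (intro measurable_If borel_measurable_times fm gm borel_measurable_const
      borel_measurable_less m1 m2)
  have inty: "integrable leb01 (\<lambda>y. ?h (x, y))" for x
    using integrable_cut[of "\<lambda>y. f x * g y" "{..<x}"] g by simp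
  have int: "integrable (leb01 \<Otimes>\<^sub>M leb01) ?h"
  proof (rule leb01_pair.Fubini_integrable)
    have "integrable leb01 (\<lambda>x. cmod (f x) * (LINT t|leb01. cmod (g t)))" using f by simp
    then show "integrable leb01 (\<lambda>x. LINT y|leb01. cmod (?h (x, y)))"
    proof (rule Bochner_Integration.integrable_bound)
      show "AE x in leb01. norm (LINT y|leb01. cmod (?h (x, y))) \<le> norm (cmod (f x) * (LINT t|leb01. cmod (g t)))"
      proof (rule AE_I2)
        fix x
        have "(LINT y|leb01. cmod (?h (x, y))) \<le> (LINT y|leb01. cmod (f x) * cmod (g y))"
        proof (rule integral_mono)
          show "integrable leb01 (\<lambda>y. cmod (?h (x, y)))" by (rule integrable_norm[OF inty])
          show "integrable leb01 (\<lambda>y. cmod (f x) * cmod (g y))" using g by simp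
        qed (simp add: indicator_def norm_mult)
        also have "\<dots> = cmod (f x) * (LINT t|leb01. cmod (g t))" by simp
        finally show "norm (LINT y|leb01. cmod (?h (x, y))) \<le> norm (cmod (f x) * (LINT t|leb01. cmod (g t)))"
          by simp
      qed
      have "(\<lambda>(x, y). cmod (indicator {..<x} y *\<^sub>R (f x * g y))) \<in> borel_measurable (leb01 \<Otimes>\<^sub>M leb01)"
        using measurable_compose[OF meas borel_measurable_norm] by (simp only: case_prod_beta')
      from leb01.borel_measurable_lebesgue_integral[OF this]
      show "(\<lambda>x. LINT y|leb01. cmod (?h (x, y))) \<in> borel_measurable leb01"
        by (simp only: prod.case)
    qed
    show "AE x in leb01. integrable leb01 (\<lambda>y. ?h (x, y))"
      by (intro AE_I2 inty)
  qed (rule meas)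
  have "(LINT x|leb01. f x * prim g x) = (LINT x|leb01. LINT t|leb01. ?h (x, t))"
  proof (intro Bochner_Integration.integral_cong refl)
    fix x
    have "f x * prim g x = (LINT t|leb01. f x * (indicator {..<x} t *\<^sub>R g t))"
      by (simp only: prim_def integral_mult_right_zero)
    then show "f x * prim g x = (LINT t|leb01. ?h (x, t))"
      by (simp only: prod.case mult_scaleR_right)
  qed
  also have "\<dots> = (LINT t|leb01. LINT x|leb01. ?h (x, t))"
    by (rule leb01_pair.Fubini_integral[of "\<lambda>x t. ?h (x, t)", symmetric]) (use int in \<open>simp only: prod.case\<close>)
  also have "\<dots> = (LINT t|leb01. coprim f t * g t)"
  proof (intro Bochner_Integration.integral_cong refl)
    fix t
    have "coprim f t * g t = (LINT x|leb01. (indicator {t<..} x *\<^sub>R f x) * g t)"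
      by (simp only: coprim_def integral_mult_left_zero)
    also have "\<dots> = (LINT x|leb01. ?h (x, t))"
      by (intro Bochner_Integration.integral_cong refl) (simp add: indicator_def)
    finally show "(LINT x|leb01. ?h (x, t)) = coprim f t * g t" by simp
  qed
  finally show ?thesis .
qed

section \<open>The fundamental lemma of the calculus of variations\<close>

text \<open>The sets over which \<open>f\<close> integrates to zero are closed under complements and
  countable disjoint unions and contain the intersection-stable family of open intervals, so
  Dynkin's theorem reaches all Borel sets. Lebesgue sets differ from Borel sets by null
  sets.\<close>

lemma integrals_over_intervals_zero_imp_AE_zero:
  fixes f :: "real \<Rightarrow> complex"
  assumes f: "integrable leb01 f"
    and zero: "\<And>a b. 0 \<le> a \<Longrightarrow> a < b \<Longrightarrow> b \<le> 1 \<Longrightarrow> (LINT x|leb01. indicator {a<..<b} x *\<^sub>R f x) = 0"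
  shows "AE x in leb01. f x = 0"
proof (rule leb01.density_zero[OF f])
  have borel: "(LINT x|leb01. indicator S x *\<^sub>R f x) = 0" if S: "S \<in> sets borel" for S
  proof -
    have S': "S \<in> sigma_sets UNIV (range (\<lambda>(a, b). {a<..<b::real}))"
      using S by (simp add: borel_eq_box[where 'a=real])
    have all: "(LINT x|leb01. f x) = 0"
    proof -
      have "(LINT x|leb01. f x) = (LINT x|leb01. indicator {0<..<1} x *\<^sub>R f x)"
        by (intro Bochner_Integration.integral_cong) auto
      with zero[of 0 1] show ?thesis by simp
    qed
    have bor: "T \<in> sets borel" if "T \<in> sigma_sets UNIV (range (\<lambda>(a, b). {a<..<b::real}))" for T
      using that by (simp add: borel_eq_box[where 'a=real])
    have "Int_stable (range (\<lambda>(a, b). {a<..<b::real}))"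
      by (auto simp: Int_stable_def)
    moreover have "range (\<lambda>(a, b). {a<..<b::real}) \<subseteq> Pow UNIV" by simp
    ultimately show ?thesis
      using S'
    proof (induction S rule: sigma_sets_induct_disjoint)
      case (basic A)
      then obtain a b where A: "A = {a<..<b}" by auto
      have "(LINT x|leb01. indicator A x *\<^sub>R f x) =
        (LINT x|leb01. indicator {max a 0<..<min b 1} x *\<^sub>R f x)"
        unfolding A by (intro Bochner_Integration.integral_cong) (auto simp: indicator_def)
      also have "\<dots> = 0"
        using zero[of "max a 0" "min b 1"] by (cases "max a 0 < min b 1") auto
      finally show ?case .
    next
      case empty then show ?case by simp
    next
      case (compl A)
      have "(LINT x|leb01. indicator (UNIV - A) x *\<^sub>R f x) = (LINT x|leb01. f x - indicator A x *\<^sub>R f x)"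
        by (intro Bochner_Integration.integral_cong) (auto simp: indicator_def)
      also have "\<dots> = 0"
        using compl f all bor integrable_cut[OF f, of A] by (subst Bochner_Integration.integral_diff) auto
      finally show ?case .
    next
      case (union A)
      have A: "A i \<in> sets borel" for i using union(2) by (intro bor) auto
      let ?B = "\<lambda>i. A i \<inter> {0<..<1}"
      have restrict: "set_lebesgue_integral leb01 (S \<inter> {0<..<1}) f = (LINT x|leb01. indicator S x *\<^sub>R f x)" for S
        unfolding set_lebesgue_integral_def
        by (intro Bochner_Integration.integral_cong) (auto simp: indicator_def)
      have "set_lebesgue_integral leb01 (\<Union>i. ?B i) f = (\<Sum>i. set_lebesgue_integral leb01 (?B i) f)"
      proof (rule lebesgue_integral_countable_add)
        show "?B i \<in> sets leb01" for i using A by (rule sets_leb01)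
        show "?B i \<inter> ?B j = {}" if "i \<noteq> j" for i j
          using union(1) that by (auto simp: disjoint_family_on_def)
        have "(\<Union>i. ?B i) \<in> sets leb01" using sets_leb01[OF A] by (intro sets.countable_UN) auto
        then show "set_integrable leb01 (\<Union>i. ?B i) f"
          unfolding set_integrable_def by (rule integrable_mult_indicator[OF _ f])
      qed
      moreover have "(\<Union>i. ?B i) = (\<Union>i. A i) \<inter> {0<..<1}" by auto
      ultimately show ?case using union(3) by (simp only: restrict suminf_zero)
    qed
  qed
  fix A assume "A \<in> sets leb01"
  then obtain B where B: "B \<in> sets lebesgue" "A = B \<inter> {0<..<1}" by (auto simp: sets_restrict_space)
  from sets_completionE[OF B(1)] obtain S N N' where S: "B = S \<union> N" "N \<subseteq> N'" "N' \<in> null_sets lborel" "S \<in> sets lborel" .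
  have "AE x in lebesgue. x \<notin> N'"
    using S(3) by (intro AE_not_in null_sets_completionI)
  then have "AE x in leb01. x \<notin> N'"
    by (auto simp: AE_restrict_space_iff elim: eventually_mono)
  then have "AE x in leb01. indicator A x *\<^sub>R f x = indicator S x *\<^sub>R f x"
    using AE_leb01_mem by eventually_elim (use S B in \<open>auto simp: indicator_def\<close>)
  then have "(LINT x|leb01. indicator A x *\<^sub>R f x) = (LINT x|leb01. indicator S x *\<^sub>R f x)"
    using integrable_mult_indicator[OF \<open>A \<in> sets leb01\<close> f] integrable_cut[OF f, of S] S(4)
    by (intro integral_cong_AE) (auto intro: borel_measurable_integrable)
  with borel[of S] S(4) show "set_lebesgue_integral leb01 A f = 0"
    by (simp add: set_lebesgue_integral_def)
qed

section \<open>Test functions of class C1 and approximation of indicators\<close>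

lemma C1_differentiable_onI_real:
  assumes "\<And>x. (f has_real_derivative D x) (at x)" "continuous_on UNIV D"
  shows "f C1_differentiable_on UNIV"
  using assms unfolding C1_differentiable_on_def
  by (auto simp: has_real_derivative_iff_has_vector_derivative)

lemma test_functionD:
  assumes "test_function \<phi>"
  shows "\<And>x. (\<phi> has_real_derivative deriv \<phi> x) (at x)" "continuous_on UNIV (deriv \<phi>)" "continuous_on UNIV \<phi>"
proof -
  obtain D where D: "\<And>x. (\<phi> has_real_derivative D x) (at x)" "continuous_on UNIV D"
    using assms unfolding test_function_def C1_differentiable_on_def
    by (auto simp: has_real_derivative_iff_has_vector_derivative)
  then have "deriv \<phi> = D" by (auto intro: DERIV_imp_deriv)
  with D show "(\<phi> has_real_derivative deriv \<phi> x) (at x)" "continuous_on UNIV (deriv \<phi>)" for x by auto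
  show "continuous_on UNIV \<phi>"
    using D(1) by (auto intro!: continuous_at_imp_continuous_on DERIV_isCont)
qed

lemma test_function_supp:
  assumes "test_function \<phi>"
  obtains a b where "0 < a" "a < b" "b < 1" "\<And>x. x \<le> a \<or> x \<ge> b \<Longrightarrow> \<phi> x = 0"
proof -
  from assms obtain K where K: "compact K" "K \<subseteq> {0<..<1}" "\<And>x. x \<notin> K \<Longrightarrow> \<phi> x = 0"
    unfolding test_function_def by auto
  obtain a b where ab: "0 < a" "b < 1" "K \<subseteq> {a..b}"
  proof (cases "K = {}")
    case True
    then show ?thesis using that[of "1/2" "1/2"] by auto
  next
    case False
    obtain a where "a \<in> K" "\<And>x. x \<in> K \<Longrightarrow> a \<le> x" using compact_attains_inf[OF K(1) False] by auto
    moreover obtain b where "b \<in> K" "\<And>x. x \<in> K \<Longrightarrow> x \<le> b" using compact_attains_sup[OF K(1) False] by auto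
    ultimately show ?thesis using K(2) by (intro that[of a b]) auto
  qed
  \<comment> \<open>Enlarging the interval gives a' < b' even if \<open>K\<close> is empty or a
    single point, and makes \<open>\<phi>\<close> vanish at both end points.\<close>
  define a' b' where "a' = min (a/2) (1/3)" and "b' = max ((b+1)/2) (2/3)"
  show ?thesis
  proof (rule that[of a' b'])
    show "\<phi> x = 0" if "x \<le> a' \<or> x \<ge> b'" for x
    proof (rule K(3))
      have "a' < a" "b < b'" using ab by (auto simp: a'_def b'_def less_max_iff_disj min_less_iff_disj)
      with that ab(3) show "x \<notin> K" by auto
    qed
  qed (use ab in \<open>auto simp: a'_def b'_def\<close>)
qed

lemma test_functionI:
  assumes "\<And>x. (\<phi> has_real_derivative D x) (at x)" "continuous_on UNIV D"
    "0 < a" "b < 1" "\<And>x. x \<notin> {a..b} \<Longrightarrow> \<phi> x = 0"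
  shows "test_function \<phi>"
  unfolding test_function_def
  using C1_differentiable_onI_real[OF assms(1,2)] assms(3-) by (auto intro!: exI[of _ "{a..b}"])

text \<open>Test functions only have to be C1, so the squared positive part suffices as a building
  block. At 0 the difference quotient is bounded by |y|.\<close>

lemma DERIV_max0_sq: "((\<lambda>x. (max 0 x)\<^sup>2) has_real_derivative 2 * max 0 x) (at (x::real))"
proof -
  consider "x < 0" | "x = 0" | "x > 0" by linarith
  then show ?thesis
  proof cases
    case 1
    have "((\<lambda>x. 0) has_real_derivative 2 * max 0 x) (at x)" using 1 by simp
    then show ?thesis
      by (rule has_field_derivative_transform_within_open[where S="{..<0}"]) (use 1 in auto)
  next
    case 3
    have "((\<lambda>x. x\<^sup>2) has_real_derivative 2 * max 0 x) (at x)" using 3 by (auto intro!: derivative_eq_intros)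
    then show ?thesis
      by (rule has_field_derivative_transform_within_open[where S="{0<..}"]) (use 3 in auto)
  next
    case 2
    have "((\<lambda>y. (max 0 y)\<^sup>2 / y) \<longlongrightarrow> 0) (at (0::real))"
    proof (rule Lim_null_comparison)
      show "\<forall>\<^sub>F y in at (0::real). norm ((max 0 y)\<^sup>2 / y) \<le> \<bar>y\<bar>"
        by (intro always_eventually) (auto simp: max_def power2_eq_square)
      show "((\<lambda>y. \<bar>y\<bar>) \<longlongrightarrow> 0) (at (0::real))" by (rule tendsto_rabs_zero) (rule tendsto_ident_at)
    qed
    then show ?thesis using 2 by (simp add: has_field_derivative_iff)
  qed
qed

definition bump :: "real \<Rightarrow> real \<Rightarrow> real \<Rightarrow> real" where
  "bump a b x = (max 0 (x - a))\<^sup>2 * (max 0 (b - x))\<^sup>2"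

lemma bump_nonneg: "0 \<le> bump a b x" and bump_pos: "a < x \<Longrightarrow> x < b \<Longrightarrow> 0 < bump a b x"
  and bump_outside: "x \<notin> {a<..<b} \<Longrightarrow> bump a b x = 0"
  by (auto simp: bump_def max_def)

text \<open>As \<epsilon> tends to 0, the quotient tends to 1 where the bump is positive and stays 0
  elsewhere, with values between 0 and 1: an approximation of the indicator suited to dominated
  convergence.\<close>

lemma test_function_bump:
  assumes "0 < a" "b < 1" "\<epsilon> > 0"
  shows "test_function (\<lambda>x. bump a b x / (bump a b x + \<epsilon>))"
proof (rule test_functionI)
  let ?D = "\<lambda>x. 2 * max 0 (x - a) * (max 0 (b - x))\<^sup>2 - 2 * max 0 (b - x) * (max 0 (x - a))\<^sup>2"
  have D: "((\<lambda>x. bump a b x) has_real_derivative ?D x) (at x)" for x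
    unfolding bump_def
    by (rule derivative_eq_intros DERIV_chain2[OF DERIV_max0_sq] refl)+ (simp add: algebra_simps)
  have nz: "bump a b x + \<epsilon> \<noteq> 0" for x using bump_nonneg[of a b x] assms by linarith
  show "((\<lambda>x. bump a b x / (bump a b x + \<epsilon>)) has_real_derivative
     (?D x * (bump a b x + \<epsilon>) - bump a b x * (?D x + 0)) / ((bump a b x + \<epsilon>) * (bump a b x + \<epsilon>))) (at x)" for x
    by (intro DERIV_divide DERIV_add D DERIV_const nz)
  show "continuous_on UNIV (\<lambda>x. (?D x * (bump a b x + \<epsilon>) - bump a b x * (?D x + 0)) / ((bump a b x + \<epsilon>) * (bump a b x + \<epsilon>)))"
    using nz unfolding bump_def by (intro continuous_intros) auto
qed (use assms in \<open>auto simp: bump_outside\<close>)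

lemma integrable_mult_bounded_continuous:
  assumes "integrable leb01 f" "continuous_on UNIV g" "\<And>x. x \<in> {0<..<1} \<Longrightarrow> \<bar>g x\<bar> \<le> B"
  shows "integrable leb01 (\<lambda>x. f x * complex_of_real (g x))"
  using assms by (intro integrable_bounded_mult[where B=B] AE_I2 borel_measurable_leb01
     borel_measurable_continuous_onI continuous_intros) auto

lemma AE_zero_if_test_function_integrals_zero:
  assumes f: "integrable leb01 f"
    and zero: "\<And>\<phi>. test_function \<phi> \<Longrightarrow> (LINT x|leb01. f x * complex_of_real (\<phi> x)) = 0"
  shows "AE x in leb01. f x = 0"
proof (rule integrals_over_intervals_zero_imp_AE_zero[OF f])
  fix a b :: real assume ab: "0 \<le> a" "a < b" "b \<le> 1"
  \<comment> \<open>\<open>e n\<close> both pulls the support into the open unit interval and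
    regularises the quotient. For small n the shrunken interval may be empty; then
    \<open>\<psi> n\<close> is 0.\<close>
  define e where "e n = inverse (real (Suc n))" for n
  have e: "e n > 0" "e \<longlonglongrightarrow> 0" for n
    using LIMSEQ_inverse_real_of_nat by (simp_all add: e_def[abs_def])
  define \<psi> where "\<psi> n x = bump (a + e n) (b - e n) x / (bump (a + e n) (b - e n) x + e n)" for n x
  have test: "test_function (\<psi> n)" for n
    unfolding \<psi>_def using ab e(1)[of n] by (intro test_function_bump) auto
  have bound: "0 \<le> \<psi> n x \<and> \<psi> n x \<le> 1" for n x
    unfolding \<psi>_def using bump_nonneg[of "a + e n" "b - e n" x] e(1)[of n] by (auto simp: field_simps)
  have "(\<lambda>n. LINT x|leb01. f x * complex_of_real (\<psi> n x)) \<longlonglongrightarrow> (LINT x|leb01. indicator {a<..<b} x *\<^sub>R f x)"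
  proof (rule integral_dominated_convergence)
    show "integrable leb01 (\<lambda>x. cmod (f x))" using f by simp
    show "(\<lambda>x. indicator {a<..<b} x *\<^sub>R f x) \<in> borel_measurable leb01"
      by (intro borel_measurable_integrable integrable_cut f) simp
    show "(\<lambda>x. f x * complex_of_real (\<psi> n x)) \<in> borel_measurable leb01" for n
      using bound by (intro borel_measurable_integrable integrable_mult_bounded_continuous[where B=1] f test_functionD(3) test) auto
    show "AE x in leb01. cmod (f x * complex_of_real (\<psi> n x)) \<le> cmod (f x)" for n
      using bound[of n] by (auto simp: norm_mult intro!: mult_left_le)
    show "AE x in leb01. (\<lambda>n. f x * complex_of_real (\<psi> n x)) \<longlonglongrightarrow> indicator {a<..<b} x *\<^sub>R f x"
    proof (rule AE_I2)
      fix x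
      have "(\<lambda>n. \<psi> n x) \<longlonglongrightarrow> indicator {a<..<b} x"
      proof (cases "x \<in> {a<..<b}")
        case True
        have "(\<lambda>n. bump (a + e n) (b - e n) x) \<longlonglongrightarrow> bump (a + 0) (b - 0) x"
          unfolding bump_def by (intro tendsto_intros e)
        then have "(\<lambda>n. \<psi> n x) \<longlonglongrightarrow> bump (a + 0) (b - 0) x / (bump (a + 0) (b - 0) x + 0)"
          unfolding \<psi>_def using bump_pos[of a x b] True by (intro tendsto_intros e) auto
        then show ?thesis using True bump_pos[of a x b] by simp
      next
        case False
        then have "\<psi> n x = 0" for n
          unfolding \<psi>_def using e(1)[of n] by (subst bump_outside) auto
        then show ?thesis using False by simp
      qed
      then have "(\<lambda>n. f x * complex_of_real (\<psi> n x)) \<longlonglongrightarrow> f x * complex_of_real (indicator {a<..<b} x)"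
        by (intro tendsto_intros)
      then show "(\<lambda>n. f x * complex_of_real (\<psi> n x)) \<longlonglongrightarrow> indicator {a<..<b} x *\<^sub>R f x"
        by (simp add: scaleR_conv_of_real mult.commute)
    qed
  qed
  then show "(LINT x|leb01. indicator {a<..<b} x *\<^sub>R f x) = 0"
    using zero[OF test] by (simp add: LIMSEQ_const_iff)
qed

section \<open>Weak derivatives of primitives\<close>

text \<open>End points are null sets, so the cut-off integral becomes one over a compact interval,
  where the fundamental theorem for continuous derivatives applies.\<close>

lemma coprim_FTC:
  assumes D: "\<And>x. (\<phi> has_real_derivative D x) (at x)" and c: "continuous_on UNIV D" and t: "0 \<le> t" "t < 1"
  shows "coprim (\<lambda>x. complex_of_real (D x)) t = complex_of_real (\<phi> 1 - \<phi> t)"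
proof -
  have "coprim (\<lambda>x. complex_of_real (D x)) t
     = (LINT x|lebesgue. indicator {0<..<1} x *\<^sub>R (indicator {t<..} x *\<^sub>R complex_of_real (D x)))"
    unfolding coprim_def by (rule integral_restrict_space) simp
  also have "\<dots> = (LINT x|lborel. indicator {0<..<1} x *\<^sub>R (indicator {t<..} x *\<^sub>R complex_of_real (D x)))"
    using borel_measurable_continuous_onI[OF c] by (intro integral_completion) measurable
  also have "\<dots> = (LINT x|lborel. indicator {t..1} x *\<^sub>R complex_of_real (D x))"
  proof (rule integral_cong_AE)
    show "AE x in lborel. indicator {0<..<1} x *\<^sub>R (indicator {t<..} x *\<^sub>R complex_of_real (D x))
       = indicator {t..1} x *\<^sub>R complex_of_real (D x)"
      using AE_lborel_singleton[of t] AE_lborel_singleton[of 1]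
      by eventually_elim (use t in \<open>auto simp: indicator_def\<close>)
  qed (use borel_measurable_continuous_onI[OF c] in measurable)
  also have "\<dots> = complex_of_real (\<phi> 1) - complex_of_real (\<phi> t)"
  proof (rule integral_FTC_Icc)
    show "((\<lambda>x. complex_of_real (\<phi> x)) has_vector_derivative complex_of_real (D x)) (at x within {t..1})" for x
      using D by (intro has_vector_derivative_of_real)
         (auto intro: has_field_derivative_at_within simp flip: has_real_derivative_iff_has_vector_derivative)
    show "continuous_on {t..1} (\<lambda>x. complex_of_real (D x))"
      using c by (intro continuous_intros) (auto intro: continuous_on_subset)
  qed (use t in auto)
  finally show ?thesis by simp
qed

lemma test_function_0_1: "test_function \<phi> \<Longrightarrow> \<phi> 0 = 0" "test_function \<phi> \<Longrightarrow> \<phi> 1 = 0"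
  by (erule test_function_supp, simp)+

lemma coprim_deriv_test_function:
  assumes "test_function \<phi>" "0 \<le> t" "t < 1"
  shows "coprim (\<lambda>x. complex_of_real (deriv \<phi> x)) t = - complex_of_real (\<phi> t)"
  using coprim_FTC[OF test_functionD(1,2)[OF assms(1)] assms(2,3)] test_function_0_1[OF assms(1)] by simp

lemma bounded_on_unit:
  assumes "continuous_on UNIV (g :: real \<Rightarrow> real)"
  obtains B where "\<And>x. x \<in> {0<..<1} \<Longrightarrow> \<bar>g x\<bar> \<le> B"
proof -
  have "compact (g ` {0..1})"
    using assms by (intro compact_continuous_image) (auto intro: continuous_on_subset)
  then have "bounded (g ` {0..1})" by (rule compact_imp_bounded)
  then obtain B where "\<forall>x\<in>{0..1}. \<bar>g x\<bar> \<le> B"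
    unfolding bounded_iff by auto
  then show ?thesis by (intro that[of B]) auto
qed

lemma integrable_mult_continuous:
  assumes "integrable leb01 f" "continuous_on UNIV g"
  shows "integrable leb01 (\<lambda>x. f x * complex_of_real (g x))"
proof -
  obtain B where "\<And>x. x \<in> {0<..<1} \<Longrightarrow> \<bar>g x\<bar> \<le> B" using bounded_on_unit[OF assms(2)] by blast
  then show ?thesis by (rule integrable_mult_bounded_continuous[OF assms])
qed

lemma integrable_continuous:
  assumes "continuous_on UNIV g"
  shows "integrable leb01 (\<lambda>x. complex_of_real (g x))"
  using integrable_mult_continuous[of "\<lambda>_. 1" g] assms by simp

lemma integral_coprim_0: "(LINT x|leb01. f x) = coprim f 0"
  unfolding coprim_def by (intro Bochner_Integration.integral_cong) auto

lemma integral_deriv_test_function: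
  assumes "test_function \<phi>"
  shows "(LINT x|leb01. complex_of_real (deriv \<phi> x)) = 0"
  unfolding integral_coprim_0 using coprim_deriv_test_function[OF assms, of 0] test_function_0_1[OF assms] by simp

text \<open>By \<open>prim_swap\<close> the primitive moves from \<open>v\<close> onto
  \<open>deriv \<phi>\<close>, where \<open>coprim\<close> gives \<open>- \<phi>\<close> because
  \<phi> vanishes at 1. The constant disappears since \<open>deriv \<phi>\<close> has mean
  zero.\<close>

lemma is_weak_deriv_prim:
  assumes v: "integrable leb01 v"
  shows "is_weak_deriv (\<lambda>x. c + prim v x) v"
  unfolding is_weak_deriv_def
proof (intro allI impI)
  fix \<phi> assume \<phi>: "test_function \<phi>"
  note c = test_functionD(2)[OF \<phi>]
  have "(LINT x|leb01. (c + prim v x) * complex_of_real (deriv \<phi> x)) =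
     (LINT x|leb01. c * complex_of_real (deriv \<phi> x) + prim v x * complex_of_real (deriv \<phi> x))"
    by (simp add: algebra_simps)
  also have "\<dots> = c * 0 + (LINT x|leb01. complex_of_real (deriv \<phi> x) * prim v x)"
    using integrable_continuous[OF c] integrable_mult_continuous[OF integrable_prim[OF v] c]
      integral_deriv_test_function[OF \<phi>] by (simp add: mult.commute)
  also have "\<dots> = (LINT t|leb01. coprim (\<lambda>x. complex_of_real (deriv \<phi> x)) t * v t)"
    using prim_swap[OF integrable_continuous[OF c] v] by simp
  also have "\<dots> = (LINT t|leb01. - (v t * complex_of_real (\<phi> t)))"
    using coprim_deriv_test_function[OF \<phi>] by (intro Bochner_Integration.integral_cong) auto
  finally show "(LINT x|leb01. (c + prim v x) * complex_of_real (deriv \<phi> x)) =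
      - (LINT x|leb01. v x * complex_of_real (\<phi> x))" by simp
qed

text \<open>The antiderivative is constant on each side of the support of \<eta>: 0 on the left by
  normalisation, and the integral of \<eta> on the right. Mean zero is exactly what compact support
  demands.\<close>

lemma test_function_antiderivative:
  assumes \<eta>: "test_function \<eta>" and zero: "(LINT x|leb01. complex_of_real (\<eta> x)) = 0"
  obtains \<phi> where "test_function \<phi>" "deriv \<phi> = \<eta>"
proof -
  define \<phi> where "\<phi> = (\<lambda>x. LBINT y=ereal 0..ereal x. \<eta> y)"
  note c = test_functionD(3)[OF \<eta>]
  have D: "(\<phi> has_real_derivative \<eta> x) (at x)" for x
  proof -
    define M where "M = \<bar>x\<bar> + 1"
    have "((\<lambda>u. LBINT y=ereal 0..ereal u. \<eta> y) has_vector_derivative \<eta> x) (at x within {-M..M})"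
      by (rule interval_integral_FTC2) (use c in \<open>auto simp: M_def intro: continuous_on_subset\<close>)
    then have "(\<phi> has_vector_derivative \<eta> x) (at x within {-M..M})"
      by (simp only: \<phi>_def)
    moreover have "at x within {-M..M} = at x"
      by (rule at_within_interior) (auto simp: M_def interior_atLeastAtMost_real)
    ultimately show ?thesis
      by (simp only: has_real_derivative_iff_has_vector_derivative)
  qed
  obtain a b where ab: "0 < a" "a < b" "b < 1" "\<And>x. x \<le> a \<or> x \<ge> b \<Longrightarrow> \<eta> x = 0"
    using test_function_supp[OF \<eta>] by metis
  have "\<phi> 0 = 0" by (simp add: \<phi>_def)
  moreover have "\<phi> 1 = \<phi> 0"
    using coprim_FTC[OF D c, of 0] zero unfolding integral_coprim_0 by simp
  moreover have "\<phi> x = \<phi> 0" if "x \<le> a" for x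
  proof -
    have "(\<phi> has_derivative (\<lambda>h. 0)) (at y within {..a})" if "y \<in> {..a}" for y
    proof -
      have "(\<phi> has_real_derivative 0) (at y)" using D[of y] ab(4)[of y] that by simp
      then show ?thesis
        by (auto simp: has_field_derivative_def lambda_zero intro: has_derivative_at_withinI)
    qed
    from has_derivative_zero_unique[OF convex_real_interval(2) this, of x 0] show ?thesis using that ab by simp
  qed
  moreover have "\<phi> x = \<phi> 1" if "b \<le> x" for x
  proof -
    have "(\<phi> has_derivative (\<lambda>h. 0)) (at y within {b..})" if "y \<in> {b..}" for y
    proof -
      have "(\<phi> has_real_derivative 0) (at y)" using D[of y] ab(4)[of y] that by simp
      then show ?thesis
        by (auto simp: has_field_derivative_def lambda_zero intro: has_derivative_at_withinI)
    qed
    from has_derivative_zero_unique[OF convex_real_interval(1) this, of x 1] show ?thesis using that ab by simp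
  qed
  ultimately have "\<phi> x = 0" if "x \<notin> {a..b}" for x using that by (cases "x \<le> a") auto
  with D c ab have "test_function \<phi>" by (intro test_functionI[of \<phi> \<eta> a b]) auto
  moreover have "deriv \<phi> = \<eta>" using D by (auto intro: DERIV_imp_deriv)
  ultimately show ?thesis by (rule that)
qed

lemma test_function_linear:
  assumes "test_function \<phi>" "test_function \<psi>"
  shows "test_function (\<lambda>x. \<phi> x + c * \<psi> x)"
proof -
  obtain a b where 1: "0 < a" "a < b" "b < 1" "\<And>x. x \<le> a \<or> x \<ge> b \<Longrightarrow> \<phi> x = 0"
    using test_function_supp[OF assms(1)] by metis
  obtain a' b' where 2: "0 < a'" "a' < b'" "b' < 1" "\<And>x. x \<le> a' \<or> x \<ge> b' \<Longrightarrow> \<psi> x = 0"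
    using test_function_supp[OF assms(2)] by metis
  show ?thesis
  proof (rule test_functionI)
    show "((\<lambda>x. \<phi> x + c * \<psi> x) has_real_derivative deriv \<phi> x + c * deriv \<psi> x) (at x)" for x
      by (intro DERIV_add DERIV_cmult test_functionD(1) assms)
    show "continuous_on UNIV (\<lambda>x. deriv \<phi> x + c * deriv \<psi> x)"
      by (intro continuous_intros test_functionD(2) assms)
    show "0 < min a a'" "max b b' < 1" using 1 2 by auto
    show "\<phi> x + c * \<psi> x = 0" if "x \<notin> {min a a'..max b b'}" for x
    proof -
      from that have "x < min a a' \<or> max b b' < x" by auto
      then show ?thesis using 1(4)[of x] 2(4)[of x] by auto
    qed
  qed
qed

lemma test_function_unit_mass:
  obtains \<psi> where "test_function \<psi>" "(LINT x|leb01. complex_of_real (\<psi> x)) = 1"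
proof -
  define \<rho> where "\<rho> x = bump (1/4) (3/4) x / (bump (1/4) (3/4) x + 1)" for x
  have \<rho>: "test_function \<rho>" unfolding \<rho>_def by (rule test_function_bump) auto
  have nn: "\<rho> x \<ge> 0" for x unfolding \<rho>_def using bump_nonneg[of "1/4" "3/4" x] by auto
  have int: "integrable leb01 \<rho>"
    using integrable_continuous[OF test_functionD(3)[OF \<rho>]] by (simp add: complex_of_real_integrable_eq)
  define m where "m = (LINT x|leb01. \<rho> x)"
  have m: "(LINT x|leb01. complex_of_real (\<rho> x)) = complex_of_real m" by (simp add: m_def)
  have "m \<noteq> 0"
  proof
    assume "m = 0"
    then have "AE x in leb01. \<rho> x = 0"
      using int nn by (simp add: m_def integral_nonneg_eq_0_iff_AE)
    then have "AE x in leb01. x \<notin> {1/4<..<3/4}"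
    proof eventually_elim
      case (elim x)
      then show ?case using bump_pos[of "1/4" x "3/4"] by (auto simp: \<rho>_def)
    qed
    then have "measure leb01 {1/4<..<3/4} = 0"
      by (subst leb01.prob_eq_0) (auto simp: sets_restrict_space intro!: image_eqI[of _ _ "{1/4<..<3/4}"])
    moreover have "measure leb01 {1/4<..<3/4} = measure lebesgue {1/4<..<3/4::real}"
      by (rule measure_restrict_space) auto
    ultimately show False by simp
  qed
  then have "(LINT x|leb01. complex_of_real (0 + (1 / m) * \<rho> x)) = 1"
    by (simp add: m_def)
  moreover have "test_function (\<lambda>x. 0 + (1 / m) * \<rho> x)"
  proof (rule test_function_linear[OF _ \<rho>])
    show "test_function (\<lambda>x. 0)" by (rule test_functionI[where D="\<lambda>x. 0" and a="1/2" and b="1/2"]) auto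
  qed
  ultimately show ?thesis by (rule that[rotated])
qed

text \<open>Du Bois-Reymond: test functions of mean zero are exactly the derivatives of test functions.\<close>

lemma is_weak_deriv_imp_prim:
  assumes u: "integrable leb01 u" and v: "integrable leb01 v" and uv: "is_weak_deriv u v"
  obtains c where "AE x in leb01. u x = c + prim v x"
proof -
  define w where "w x = u x - prim v x" for x
  have w: "integrable leb01 w" unfolding w_def using u integrable_prim[OF v] by simp
  have w0: "(LINT x|leb01. w x * complex_of_real (deriv \<phi> x)) = 0" if "test_function \<phi>" for \<phi>
  proof -
    note c = test_functionD(2)[OF that]
    have "(LINT x|leb01. w x * complex_of_real (deriv \<phi> x)) =
      (LINT x|leb01. u x * complex_of_real (deriv \<phi> x)) - (LINT x|leb01. prim v x * complex_of_real (deriv \<phi> x))"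
      unfolding w_def left_diff_distrib
      by (intro Bochner_Integration.integral_diff integrable_mult_continuous c u integrable_prim v)
    also have "\<dots> = 0"
      using uv is_weak_deriv_prim[OF v, of 0] that unfolding is_weak_deriv_def by simp
    finally show ?thesis .
  qed
  obtain \<psi>0 where \<psi>0: "test_function \<psi>0" "(LINT x|leb01. complex_of_real (\<psi>0 x)) = 1"
    using test_function_unit_mass by blast
  \<comment> \<open>If \<open>w\<close> is constant, its mean against the unit-mass
    \<open>\<psi>0\<close> is that constant. The same \<open>\<psi>0\<close> serves to correct the
    mean of an arbitrary \<open>\<psi>\<close>.\<close>
  define c where "c = (LINT x|leb01. w x * complex_of_real (\<psi>0 x))"
  have "AE x in leb01. w x - c = 0"
  proof (rule AE_zero_if_test_function_integrals_zero)
    show "integrable leb01 (\<lambda>x. w x - c)" using w by simp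
    fix \<psi> assume \<psi>: "test_function \<psi>"
    define s where "s = (LINT x|leb01. \<psi> x)"
    have s: "(LINT x|leb01. complex_of_real (\<psi> x)) = complex_of_real s" by (simp add: s_def)
    note int = integrable_continuous[OF test_functionD(3)]
    note intw = integrable_mult_continuous[OF w test_functionD(3)]
    let ?\<eta> = "\<lambda>x. \<psi> x + (- s) * \<psi>0 x"
    have "(LINT x|leb01. complex_of_real (?\<eta> x)) = (LINT x|leb01. complex_of_real (\<psi> x) - complex_of_real s * complex_of_real (\<psi>0 x))"
      by simp
    also have "\<dots> = 0"
      using int[OF \<psi>] int[OF \<psi>0(1)] s \<psi>0(2) by (subst Bochner_Integration.integral_diff) auto
    finally obtain \<phi> where "test_function \<phi>" "deriv \<phi> = ?\<eta>"
      using test_function_antiderivative[OF test_function_linear[OF \<psi> \<psi>0(1)]] by blast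
    with w0[of \<phi>] have "0 = (LINT x|leb01. w x * complex_of_real (?\<eta> x))" by simp
    also have "\<dots> = (LINT x|leb01. w x * complex_of_real (\<psi> x) - complex_of_real s * (w x * complex_of_real (\<psi>0 x)))"
      by (simp add: algebra_simps)
    also have "\<dots> = (LINT x|leb01. w x * complex_of_real (\<psi> x)) - complex_of_real s * c"
      using intw[OF \<psi>] intw[OF \<psi>0(1)] by (subst Bochner_Integration.integral_diff) (auto simp: c_def)
    also have "\<dots> = (LINT x|leb01. w x * complex_of_real (\<psi> x)) - (LINT x|leb01. c * complex_of_real (\<psi> x))"
      using s by simp
    also have "\<dots> = (LINT x|leb01. (w x - c) * complex_of_real (\<psi> x))"
      unfolding left_diff_distrib using intw[OF \<psi>] int[OF \<psi>]
      by (subst Bochner_Integration.integral_diff) auto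
    finally show "(LINT x|leb01. (w x - c) * complex_of_real (\<psi> x)) = 0" by simp
  qed
  then have "AE x in leb01. u x = c + prim v x"
    by eventually_elim (simp add: w_def algebra_simps)
  then show ?thesis by (rule that)
qed

lemma is_weak_deriv_unique:
  assumes "integrable leb01 v" "integrable leb01 v'" "is_weak_deriv u v" "is_weak_deriv u v'"
  shows "AE x in leb01. v x = v' x"
proof -
  have "AE x in leb01. v x - v' x = 0"
  proof (rule AE_zero_if_test_function_integrals_zero)
    fix \<phi> assume \<phi>: "test_function \<phi>"
    have "- (LINT x|leb01. v x * complex_of_real (\<phi> x)) = - (LINT x|leb01. v' x * complex_of_real (\<phi> x))"
      using assms(3)[unfolded is_weak_deriv_def, rule_format, OF \<phi>]
        assms(4)[unfolded is_weak_deriv_def, rule_format, OF \<phi>] by (rule trans[OF sym])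
    then show "(LINT x|leb01. (v x - v' x) * complex_of_real (\<phi> x)) = 0"
      unfolding left_diff_distrib using integrable_mult_continuous[OF _ test_functionD(3)[OF \<phi>]] assms(1,2)
      by (subst Bochner_Integration.integral_diff) auto
  qed (use assms in auto)
  then show ?thesis by simp
qed

lemma is_weak_deriv_cong_AE:
  assumes "AE x in leb01. u x = u' x" "AE x in leb01. v x = v' x"
    and "integrable leb01 u" "integrable leb01 u'" "integrable leb01 v" "integrable leb01 v'"
    and "is_weak_deriv u v"
  shows "is_weak_deriv u' v'"
  unfolding is_weak_deriv_def
proof (intro allI impI)
  fix \<phi> assume \<phi>: "test_function \<phi>"
  note 1 = integrable_mult_continuous[OF _ test_functionD(3)[OF \<phi>]]
  note 2 = integrable_mult_continuous[OF _ test_functionD(2)[OF \<phi>]]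
  have "(LINT x|leb01. u x * complex_of_real (deriv \<phi> x)) = (LINT x|leb01. u' x * complex_of_real (deriv \<phi> x))"
    using assms(1) by (intro integral_cong_AE borel_measurable_integrable 2 assms) (auto elim: eventually_mono)
  moreover have "(LINT x|leb01. v x * complex_of_real (\<phi> x)) = (LINT x|leb01. v' x * complex_of_real (\<phi> x))"
    using assms(2) by (intro integral_cong_AE borel_measurable_integrable 1 assms) (auto elim: eventually_mono)
  ultimately show "(LINT x|leb01. u' x * complex_of_real (deriv \<phi> x)) = - (LINT x|leb01. v' x * complex_of_real (\<phi> x))"
    using assms(7) \<phi> unfolding is_weak_deriv_def by simp
qed

section \<open>The spaces \<open>L\<^sup>2\<close> and \<open>H\<^sup>2\<close>\<close>

lemma L2_I:
  assumes "f \<in> borel_measurable leb01" "integrable leb01 g" "AE x in leb01. (cmod (f x))\<^sup>2 \<le> g x"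
  shows "f \<in> L2"
  unfolding L2_def
proof (safe intro!: assms(1))
  show "integrable leb01 (\<lambda>x. (cmod (f x))\<^sup>2)"
  proof (rule Bochner_Integration.integrable_bound[OF assms(2)])
    show "(\<lambda>x. (cmod (f x))\<^sup>2) \<in> borel_measurable leb01" using assms(1) by measurable
    show "AE x in leb01. norm ((cmod (f x))\<^sup>2) \<le> norm (g x)"
      using assms(3) by eventually_elim auto
  qed
qed

lemma L2_measurable: "f \<in> L2 \<Longrightarrow> f \<in> borel_measurable leb01"
  and L2_integrable_sq: "f \<in> L2 \<Longrightarrow> integrable leb01 (\<lambda>x. (cmod (f x))\<^sup>2)"
  by (auto simp: L2_def)

lemma L2_bounded:
  assumes "f \<in> borel_measurable leb01" "AE x in leb01. cmod (f x) \<le> B"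
  shows "f \<in> L2"
proof (rule L2_I[where g="\<lambda>_. B\<^sup>2"])
  show "AE x in leb01. (cmod (f x))\<^sup>2 \<le> B\<^sup>2"
    using assms(2) by eventually_elim (auto intro: power_mono)
qed (use assms in auto)

lemma L2_mult_bounded:
  assumes "f \<in> L2" "g \<in> borel_measurable leb01" "AE x in leb01. cmod (g x) \<le> B"
  shows "(\<lambda>x. g x * f x) \<in> L2"
proof (rule L2_I[where g="\<lambda>x. B\<^sup>2 * (cmod (f x))\<^sup>2"])
  show "(\<lambda>x. g x * f x) \<in> borel_measurable leb01"
    using L2_measurable[OF assms(1)] assms(2) by (rule borel_measurable_times[rotated])
  show "AE x in leb01. (cmod (g x * f x))\<^sup>2 \<le> B\<^sup>2 * (cmod (f x))\<^sup>2"
    using assms(3)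
  proof eventually_elim
    case (elim x)
    then have "(cmod (g x))\<^sup>2 \<le> B\<^sup>2" by (auto intro: power_mono)
    then show ?case by (simp add: norm_mult power_mult_distrib mult_right_mono)
  qed
qed (use L2_integrable_sq[OF assms(1)] in auto)

lemma L2_add:
  assumes "f \<in> L2" "g \<in> L2"
  shows "(\<lambda>x. f x + g x) \<in> L2"
proof (rule L2_I[where g="\<lambda>x. 2 * (cmod (f x))\<^sup>2 + 2 * (cmod (g x))\<^sup>2"])
  show "AE x in leb01. (cmod (f x + g x))\<^sup>2 \<le> 2 * (cmod (f x))\<^sup>2 + 2 * (cmod (g x))\<^sup>2"
  proof (rule AE_I2)
    fix x
    have "(cmod (f x + g x))\<^sup>2 \<le> (cmod (f x) + cmod (g x))\<^sup>2"
      by (intro power_mono norm_triangle_ineq) auto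
    also have "\<dots> \<le> 2 * (cmod (f x))\<^sup>2 + 2 * (cmod (g x))\<^sup>2"
      using sum_squares_bound[of "cmod (f x)" "cmod (g x)"] by (simp add: power2_sum)
    finally show "(cmod (f x + g x))\<^sup>2 \<le> 2 * (cmod (f x))\<^sup>2 + 2 * (cmod (g x))\<^sup>2" .
  qed
qed (use assms in \<open>auto simp: L2_def\<close>)

lemma L2_cmult: "f \<in> L2 \<Longrightarrow> (\<lambda>x. c * f x) \<in> L2"
  by (rule L2_mult_bounded[where B="cmod c"]) auto

lemma L2_minus: "f \<in> L2 \<Longrightarrow> (\<lambda>x. - f x) \<in> L2"
  using L2_cmult[of f "-1"] by simp

lemma L2_diff: "f \<in> L2 \<Longrightarrow> g \<in> L2 \<Longrightarrow> (\<lambda>x. f x - g x) \<in> L2"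
  using L2_add[of f "\<lambda>x. - g x"] L2_minus[of g] by simp

lemma L2_const: "(\<lambda>x. c) \<in> L2"
  by (rule L2_bounded[where B="cmod c"]) auto

lemma cnj_measurable: "f \<in> borel_measurable M \<Longrightarrow> (\<lambda>x. cnj (f x)) \<in> borel_measurable M"
  by (rule measurable_compose[of f M borel cnj borel])
     (auto intro!: borel_measurable_continuous_onI continuous_intros)

lemma L2_cnj: "f \<in> L2 \<Longrightarrow> (\<lambda>x. cnj (f x)) \<in> L2"
  by (auto simp: L2_def intro: cnj_measurable)

lemma L2_integrable_mult:
  assumes "f \<in> L2" "g \<in> L2"
  shows "integrable leb01 (\<lambda>x. f x * g x)"
proof (rule Bochner_Integration.integrable_bound)
  show "integrable leb01 (\<lambda>x. (cmod (f x))\<^sup>2 + (cmod (g x))\<^sup>2)"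
    using assms by (auto intro: L2_integrable_sq)
  show "(\<lambda>x. f x * g x) \<in> borel_measurable leb01"
    using L2_measurable[OF assms(1)] L2_measurable[OF assms(2)] by (rule borel_measurable_times)
  show "AE x in leb01. norm (f x * g x) \<le> norm ((cmod (f x))\<^sup>2 + (cmod (g x))\<^sup>2)"
  proof (rule AE_I2)
    fix x
    have "2 * (cmod (f x) * cmod (g x)) \<le> (cmod (f x))\<^sup>2 + (cmod (g x))\<^sup>2"
      using sum_squares_bound[of "cmod (f x)" "cmod (g x)"] by (simp add: mult.assoc)
    moreover have "0 \<le> cmod (f x) * cmod (g x)" by simp
    ultimately have "cmod (f x) * cmod (g x) \<le> (cmod (f x))\<^sup>2 + (cmod (g x))\<^sup>2" by linarith
    then show "norm (f x * g x) \<le> norm ((cmod (f x))\<^sup>2 + (cmod (g x))\<^sup>2)"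
      by (simp add: norm_mult)
  qed
qed

lemma L2_integrable: "f \<in> L2 \<Longrightarrow> integrable leb01 f"
  using L2_integrable_mult[of f "\<lambda>_. 1"] L2_const by simp

lemma L2_integral_norm_le:
  assumes "f \<in> L2"
  shows "(LINT x|leb01. cmod (f x)) \<le> sqrt (LINT x|leb01. (cmod (f x))\<^sup>2)"
proof (rule real_le_rsqrt)
  let ?m = "LINT x|leb01. cmod (f x)"
  have f: "integrable leb01 (\<lambda>x. cmod (f x))" using L2_integrable[OF assms] by simp
  have "0 \<le> (LINT x|leb01. (cmod (f x) - ?m)\<^sup>2)" by simp
  also have "\<dots> = (LINT x|leb01. (cmod (f x))\<^sup>2 - 2 * ?m * cmod (f x) + ?m\<^sup>2)"
    by (simp add: power2_diff algebra_simps)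
  also have "\<dots> = (LINT x|leb01. (cmod (f x))\<^sup>2) - 2 * ?m * ?m + ?m\<^sup>2"
    using f L2_integrable_sq[OF assms] by (simp add: leb01.prob_space[simplified])
  finally show "?m\<^sup>2 \<le> (LINT x|leb01. (cmod (f x))\<^sup>2)" by (simp add: power2_eq_square)
qed

lemma L2_prim: "integrable leb01 v \<Longrightarrow> (\<lambda>x. c + prim v x) \<in> L2"
  by (intro L2_add L2_const L2_bounded[OF measurable_prim AE_I2[OF norm_prim_le]])

lemma weak_deriv_mem:
  assumes "u \<in> H1"
  shows "weak_deriv u \<in> L2" "is_weak_deriv u (weak_deriv u)"
proof -
  have "\<exists>v. v \<in> L2 \<and> is_weak_deriv u v" using assms by (auto simp: H1_def)
  from someI_ex[OF this] show "weak_deriv u \<in> L2" "is_weak_deriv u (weak_deriv u)"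
    by (auto simp: weak_deriv_def)
qed

text \<open>The bridge to the choice in \<open>weak_deriv\<close>: uniqueness of weak derivatives
  identifies the selected representative with a known one.\<close>

lemma weak_deriv_AE_eq:
  assumes "v \<in> L2" "AE x in leb01. u x = c + prim v x" "u \<in> borel_measurable leb01"
  shows "u \<in> H1" "AE x in leb01. weak_deriv u x = v x"
proof -
  note v = L2_integrable[OF assms(1)]
  have P: "(\<lambda>x. c + prim v x) \<in> L2" by (rule L2_prim[OF v])
  have u: "u \<in> L2"
    using assms(2) by (intro L2_I[OF assms(3) L2_integrable_sq[OF P]]) (auto elim: eventually_mono)
  have "is_weak_deriv u v"
    by (rule is_weak_deriv_cong_AE[OF _ _ _ _ v v is_weak_deriv_prim[OF v, of c]])
       (use assms(2) L2_integrable[OF u] L2_integrable[OF P] in \<open>auto elim: eventually_mono\<close>)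
  then show H: "u \<in> H1" using u assms(1) by (auto simp: H1_def)
  show "AE x in leb01. weak_deriv u x = v x"
    by (rule is_weak_deriv_unique[OF _ v])
       (use weak_deriv_mem[OF H] \<open>is_weak_deriv u v\<close> in \<open>auto intro: L2_integrable\<close>)
qed

text \<open>The solution of \<open>u'' = v\<close> with value \<open>a\<close> and slope
  \<open>b\<close> at 0. As a continuous representative it takes over the role of Sobolev
  embedding.\<close>

definition double_prim :: "complex \<Rightarrow> complex \<Rightarrow> (real \<Rightarrow> complex) \<Rightarrow> real \<Rightarrow> complex" where
  "double_prim a b v x = a + prim (\<lambda>t. b + prim v t) x"

lemma prim_cong_AE:
  assumes "AE x in leb01. f x = g x" "integrable leb01 f" "integrable leb01 g"
  shows "prim f = prim g"
  unfolding prim_def fun_eq_iff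
  using assms by (intro allI integral_cong_AE borel_measurable_integrable integrable_cut) (auto elim: eventually_mono)

text \<open>Du Bois-Reymond applied to \<open>weak_deriv u\<close> and to \<open>u\<close>. The
  outer primitive does not see null sets, so the first formula may be inserted into the
  second.\<close>

lemma H2_double_prim:
  assumes "u \<in> H2"
  obtains a b where "AE x in leb01. u x = double_prim a b (weak_deriv2 u) x"
proof -
  have 1: "u \<in> H1" "weak_deriv u \<in> H1" using assms by (auto simp: H2_def)
  then have "u \<in> L2" by (simp add: H1_def)
  note m1 = weak_deriv_mem[OF 1(1)] and m2 = weak_deriv_mem[OF 1(2)]
  obtain b where b: "AE x in leb01. weak_deriv u x = b + prim (weak_deriv2 u) x"
    using is_weak_deriv_imp_prim[OF L2_integrable[OF m1(1)] L2_integrable[OF m2(1)] m2(2)] by blast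
  obtain a where a: "AE x in leb01. u x = a + prim (weak_deriv u) x"
    using is_weak_deriv_imp_prim[OF L2_integrable[OF \<open>u \<in> L2\<close>] L2_integrable[OF m1(1)] m1(2)] by blast
  have "prim (weak_deriv u) = prim (\<lambda>t. b + prim (weak_deriv2 u) t)"
    using b L2_integrable[OF m1(1)] L2_integrable[OF L2_prim[OF L2_integrable[OF m2(1)]]]
    by (rule prim_cong_AE)
  with a show ?thesis by (intro that[of a b]) (simp add: double_prim_def)
qed

lemma double_prim_H2:
  assumes v: "v \<in> L2" and u: "AE x in leb01. u x = double_prim a b v x" "u \<in> borel_measurable leb01"
  shows "u \<in> H2" "AE x in leb01. weak_deriv2 u x = v x"
proof -
  have L2: "(\<lambda>t. b + prim v t) \<in> L2" by (rule L2_prim[OF L2_integrable[OF v]])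
  have 1: "u \<in> H1" "AE x in leb01. weak_deriv u x = b + prim v x"
    using weak_deriv_AE_eq[OF L2 _ u(2)] u(1) by (auto simp: double_prim_def)
  have "weak_deriv u \<in> H1" "AE x in leb01. weak_deriv2 u x = v x"
    using weak_deriv_AE_eq[OF v 1(2) L2_measurable[OF weak_deriv_mem(1)[OF 1(1)]]] by auto
  with 1 show "u \<in> H2" "AE x in leb01. weak_deriv2 u x = v x" by (auto simp: H2_def)
qed

lemma H2_L2: "u \<in> H2 \<Longrightarrow> u \<in> L2" and weak_deriv2_L2: "u \<in> H2 \<Longrightarrow> weak_deriv2 u \<in> L2"
  using weak_deriv_mem(1) by (auto simp: H2_def H1_def)

text \<open>\<open>X_zero\<close> controls values almost everywhere, whereas the inner product
  involves a second derivative picked by choice. Comparison with the double primitive of 0 links the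
  two.\<close>

lemma weak_deriv2_AE_zero:
  assumes "u \<in> H2" "AE x in leb01. u x = 0"
  shows "AE x in leb01. weak_deriv2 u x = 0"
proof (rule double_prim_H2(2)[where a=0 and b=0])
  have "double_prim 0 0 (\<lambda>x. 0) x = 0" for x by (simp add: double_prim_def prim_def)
  with assms(2) show "AE x in leb01. u x = double_prim 0 0 (\<lambda>x. 0) x" by simp
qed (use assms L2_measurable[OF H2_L2] L2_const in auto)

section \<open>The Riesz representation in \<open>H\<^sup>2\<close>\<close>

lemma coprim_power: "0 \<le> t \<Longrightarrow> t < 1 \<Longrightarrow>
    coprim (\<lambda>x. complex_of_real (x ^ n)) t = complex_of_real ((1 - t ^ Suc n) / Suc n)"
proof -
  assume t: "0 \<le> t" "t < 1"
  have D: "((\<lambda>x. x ^ Suc n / Suc n) has_real_derivative x ^ n) (at x)" for x :: real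
    by (auto intro!: derivative_eq_intros simp del: of_nat_Suc power_Suc)
  have "continuous_on UNIV (\<lambda>x::real. x ^ n)" by (intro continuous_intros)
  from coprim_FTC[OF D this t] show ?thesis
    by (simp only: diff_divide_distrib power_one)
qed

lemma integrable_power: "integrable leb01 (\<lambda>x. x ^ n)"
  and integral_power: "(LINT x|leb01. x ^ n) = 1 / real (Suc n)"
proof -
  have i: "integrable leb01 (\<lambda>x. complex_of_real (x ^ n))"
    by (rule integrable_continuous) (intro continuous_intros)
  then show "integrable leb01 (\<lambda>x. x ^ n)" by (simp only: complex_of_real_integrable_eq)
  have "complex_of_real (LINT x|leb01. x ^ n) = coprim (\<lambda>x. complex_of_real (x ^ n)) 0"
    unfolding integral_coprim_0[symmetric] by (rule integral_complex_of_real[symmetric])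
  also have "\<dots> = complex_of_real (1 / real (Suc n))"
    by (subst coprim_power) (simp_all del: of_nat_Suc)
  finally show "(LINT x|leb01. x ^ n) = 1 / real (Suc n)"
    by (simp only: of_real_eq_iff)
qed

lemma prim_power:
  assumes "0 < x" "x < 1"
  shows "prim (\<lambda>x. complex_of_real (x ^ n)) x = complex_of_real (x ^ Suc n / Suc n)"
proof -
  have i: "integrable leb01 (\<lambda>x. complex_of_real (x ^ n))"
    by (rule integrable_continuous) (intro continuous_intros)
  have "prim (\<lambda>x. complex_of_real (x ^ n)) x = complex_of_real (1 / real (Suc n)) - complex_of_real ((1 - x ^ Suc n) / Suc n)"
    using coprim_eq[OF i, of x] coprim_power[of x n] assms integral_power[of n]
    by (simp del: of_nat_Suc of_real_power power_Suc add: integral_complex_of_real)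
  also have "\<dots> = complex_of_real (x ^ Suc n / Suc n)"
    by (simp only: of_real_diff[symmetric]) (simp add: field_simps)
  finally show ?thesis .
qed

text \<open>Each primitive raises the power by one and divides by the new exponent; iteration gives
  the factorial gain of Volterra operators.\<close>

lemma norm_prim_power_le:
  assumes v: "integrable leb01 v" and le: "\<And>t. 0 < t \<Longrightarrow> t < 1 \<Longrightarrow> cmod (v t) \<le> A * t ^ n"
    and x: "0 < x" "x < 1"
  shows "cmod (prim v x) \<le> A / Suc n * x ^ Suc n"
proof -
  have i: "integrable leb01 (\<lambda>x. complex_of_real (x ^ n))"
    by (rule integrable_continuous) (intro continuous_intros)
  have "cmod (prim v x) \<le> (LINT t|leb01. cmod (indicator {..<x} t *\<^sub>R v t))"
    unfolding prim_def by (rule integral_norm_bound)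
  also have "\<dots> \<le> (LINT t|leb01. A * Re (indicator {..<x} t *\<^sub>R complex_of_real (t ^ n)))"
  proof (rule integral_mono)
    show "integrable leb01 (\<lambda>t. cmod (indicator {..<x} t *\<^sub>R v t))"
      by (intro integrable_norm integrable_cut v) simp
    show "integrable leb01 (\<lambda>t. A * Re (indicator {..<x} t *\<^sub>R complex_of_real (t ^ n)))"
      by (intro integrable_mult_right integrable_Re integrable_cut i) simp
  qed (use le in \<open>auto simp: indicator_def simp flip: of_real_power\<close>)
  also have "\<dots> = A * Re (prim (\<lambda>x. complex_of_real (x ^ n)) x)"
  proof -
    have "integrable leb01 (\<lambda>t. indicator {..<x} t *\<^sub>R complex_of_real (t ^ n))"
      by (rule integrable_cut[OF i]) simp
    then show ?thesis by (simp only: prim_def integral_mult_right_zero integral_Re)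
  qed
  also have "\<dots> = A / Suc n * x ^ Suc n"
    using prim_power[OF x, of n] by (simp del: of_real_power)
  finally show ?thesis .
qed

text \<open>The coordinate function clamped to the unit interval (\<open>coord_clamp\<close>):
  bounded and continuous on the whole line, as the space of the fixed point argument
  requires.\<close>

definition coord :: "real \<Rightarrow> complex" where "coord = prim (\<lambda>_. 1)"

lemma coord_eq: "0 < x \<Longrightarrow> x < 1 \<Longrightarrow> coord x = complex_of_real x"
  using prim_power[of x 0] by (simp add: coord_def)

lemma coord_clamp: "coord x = complex_of_real (max 0 (min 1 x))"
proof -
  consider "x \<le> 0" | "0 < x" "x < 1" | "x \<ge> 1" by linarith
  then show ?thesis
  proof cases
    case 1
    then have "coord x = (LINT t|leb01. 0)"
      unfolding coord_def prim_def by (intro Bochner_Integration.integral_cong) auto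
    with 1 show ?thesis by simp
  next
    case 2
    then show ?thesis by (simp add: coord_eq)
  next
    case 3
    then have "coord x = (LINT t|leb01. 1)"
      unfolding coord_def prim_def by (intro Bochner_Integration.integral_cong) auto
    with 3 show ?thesis using leb01.prob_space by simp
  qed
qed

lemma integrable_one: "integrable leb01 (\<lambda>_. 1 :: complex)" by simp

lemma integrable_coord: "integrable leb01 coord"
  unfolding coord_def by (intro integrable_prim integrable_one)

lemma L2_coord: "coord \<in> L2"
  using L2_prim[OF integrable_one, of 0] by (simp add: coord_def)

lemma norm_coord_le: "cmod (coord x) \<le> 1"
  by (simp add: coord_clamp)

lemma integral_coord: "(LINT x|leb01. coord x) = 1/2"
  and integral_coord_sq: "(LINT x|leb01. coord x * coord x) = 1/3"
proof -
  have "(LINT x|leb01. coord x) = (LINT x|leb01. complex_of_real (x ^ 1))"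
    by (intro Bochner_Integration.integral_cong) (auto simp: coord_eq)
  also have "\<dots> = 1/2" by (subst integral_complex_of_real) (simp only: integral_power, simp)
  finally show "(LINT x|leb01. coord x) = 1/2" .
  have "(LINT x|leb01. coord x * coord x) = (LINT x|leb01. complex_of_real (x ^ 2))"
    by (intro Bochner_Integration.integral_cong) (auto simp: coord_eq power2_eq_square)
  also have "\<dots> = 1/3" by (subst integral_complex_of_real) (simp only: integral_power, simp)
  finally show "(LINT x|leb01. coord x * coord x) = 1/3" .
qed

lemma integrable_mult_coord: "integrable leb01 f \<Longrightarrow> integrable leb01 (\<lambda>x. f x * coord x)"
  by (intro integrable_bounded_mult[where B=1] AE_I2 norm_coord_le) (auto intro: borel_measurable_integrable integrable_coord)

lemma prim_add: "integrable leb01 f \<Longrightarrow> integrable leb01 g \<Longrightarrow> prim (\<lambda>x. f x + g x) = (\<lambda>x. prim f x + prim g x)"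
  and prim_diff: "integrable leb01 f \<Longrightarrow> integrable leb01 g \<Longrightarrow> prim (\<lambda>x. f x - g x) = (\<lambda>x. prim f x - prim g x)"
  by (auto simp: prim_def fun_eq_iff scaleR_add_right scaleR_diff_right integrable_cut)

lemma prim_cmult: "prim (\<lambda>x. c * f x) = (\<lambda>x. c * prim f x)"
  unfolding prim_def mult_scaleR_right[symmetric] integral_mult_right_zero ..

lemma prim_const: "prim (\<lambda>_. c) = (\<lambda>x. c * coord x)"
  using prim_cmult[of c "\<lambda>_. 1"] by (simp add: coord_def)

lemma cnj_prim: "cnj (prim f x) = prim (\<lambda>t. cnj (f t)) x"
  unfolding prim_def by (subst Bochner_Integration.integral_cnj[symmetric]) (simp only: complex_cnj_scaleR)

lemma double_prim_eq:
  "integrable leb01 v \<Longrightarrow> double_prim a b v x = a + b * coord x + prim (prim v) x"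
  by (simp add: double_prim_def prim_add integrable_prim prim_const)

text \<open>The \<open>L\<^sup>2\<close>-orthogonal projection onto affine functions, with its kernel
  \<open>4 - 6t - 6x + 12tx\<close>, which is bounded by 4 on the unit square.\<close>

definition affine_part :: "(real \<Rightarrow> complex) \<Rightarrow> real \<Rightarrow> complex" where
  "affine_part k x = (LINT t|leb01. k t * (4 - 6 * coord t - 6 * coord x + 12 * coord x * coord t))"

text \<open>The numbers 4, -6 and 12 are the entries of the inverse of the Gram matrix of 1 and x,
  whose entries are 1, 1/2 and 1/3.\<close>

lemma affine_part_eq:
  assumes "integrable leb01 k"
  shows "affine_part k x = (4 * (LINT t|leb01. k t) - 6 * (LINT t|leb01. k t * coord t))
    + (12 * (LINT t|leb01. k t * coord t) - 6 * (LINT t|leb01. k t)) * coord x"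
proof -
  have "affine_part k x = (LINT t|leb01. (4 - 6 * coord x) * k t + (12 * coord x - 6) * (k t * coord t))"
    unfolding affine_part_def by (intro Bochner_Integration.integral_cong) (auto simp: algebra_simps)
  also have "\<dots> = (4 - 6 * coord x) * (LINT t|leb01. k t) + (12 * coord x - 6) * (LINT t|leb01. k t * coord t)"
    using assms integrable_mult_coord[OF assms] by simp
  finally show ?thesis by (simp add: algebra_simps)
qed

lemma affine_part_diff:
  assumes k: "integrable leb01 k" and k': "integrable leb01 k'"
  shows "affine_part (\<lambda>t. k t - k' t) x = affine_part k x - affine_part k' x"
proof -
  have 1: "(LINT t|leb01. (k t - k' t) * coord t) = (LINT t|leb01. k t * coord t) - (LINT t|leb01. k' t * coord t)"
    unfolding left_diff_distrib
    by (intro Bochner_Integration.integral_diff integrable_mult_coord k k')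
  have 2: "(LINT t|leb01. k t - k' t) = (LINT t|leb01. k t) - (LINT t|leb01. k' t)"
    by (intro Bochner_Integration.integral_diff k k')
  have 3: "integrable leb01 (\<lambda>t. k t - k' t)" using k k' by simp
  show ?thesis
    unfolding affine_part_eq[OF k] affine_part_eq[OF k'] affine_part_eq[OF 3] 1 2 by (simp add: algebra_simps)
qed

text \<open>The kernel is affine in each variable, hence a weighted average of its corner values 4,
  -2, -2, 4; the weights are the four products in the proof.\<close>

lemma kernel_bound:
  assumes "0 \<le> s" "s \<le> (1::real)" "0 \<le> t" "t \<le> 1"
  shows "\<bar>4 - 6 * t - 6 * s + 12 * s * t\<bar> \<le> 4"
proof -
  have "0 \<le> s * t" "0 \<le> s * (1 - t)" "0 \<le> (1 - s) * t" "0 \<le> (1 - s) * (1 - t)"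
    using assms by auto
  then show ?thesis by (simp add: algebra_simps abs_le_iff)
qed

lemma norm_affine_part_le:
  assumes k: "integrable leb01 k"
  shows "cmod (affine_part k x) \<le> 4 * (LINT t|leb01. cmod (k t))"
proof -
  have "cmod (affine_part k x) \<le> (LINT t|leb01. cmod (k t * (4 - 6 * coord t - 6 * coord x + 12 * coord x * coord t)))"
    unfolding affine_part_def by (rule integral_norm_bound)
  also have "\<dots> \<le> (LINT t|leb01. 4 * cmod (k t))"
  proof (rule integral_mono)
    have "integrable leb01 (\<lambda>t. (4 - 6 * coord x) * k t + (12 * coord x - 6) * (k t * coord t))"
      using k integrable_mult_coord[OF k] by simp
    also have "(\<lambda>t. (4 - 6 * coord x) * k t + (12 * coord x - 6) * (k t * coord t)) =
       (\<lambda>t. k t * (4 - 6 * coord t - 6 * coord x + 12 * coord x * coord t))"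
      by (auto simp: algebra_simps)
    finally show "integrable leb01 (\<lambda>t. cmod (k t * (4 - 6 * coord t - 6 * coord x + 12 * coord x * coord t)))"
      by (rule integrable_norm)
    fix t :: real
    define s r where "s = max 0 (min 1 x)" and "r = max 0 (min 1 t)"
    have "4 - 6 * coord t - 6 * coord x + 12 * coord x * coord t = complex_of_real (4 - 6 * r - 6 * s + 12 * s * r)"
      unfolding coord_clamp s_def[symmetric] r_def[symmetric] by simp
    moreover have "\<bar>4 - 6 * r - 6 * s + 12 * s * r\<bar> \<le> 4"
      by (rule kernel_bound) (auto simp: s_def r_def)
    ultimately have "cmod (4 - 6 * coord t - 6 * coord x + 12 * coord x * coord t) \<le> 4"
      by (simp only: norm_of_real)
    from mult_left_mono[OF this, of "cmod (k t)"]
    show "cmod (k t * (4 - 6 * coord t - 6 * coord x + 12 * coord x * coord t)) \<le> 4 * cmod (k t)"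
      by (simp add: norm_mult mult.commute)
  qed (use k in auto)
  finally show ?thesis by simp
qed

lemma continuous_coord: "continuous_on UNIV coord"
  unfolding coord_def by (rule continuous_prim[OF integrable_one])

lemma bcontfun_integrable: "integrable leb01 (apply_bcontfun (w :: real \<Rightarrow>\<^sub>C complex))"
proof (rule leb01.integrable_const_bound)
  show "AE x in leb01. cmod (apply_bcontfun w x) \<le> norm w" by (intro AE_I2 norm_bounded)
qed (intro borel_measurable_leb01 borel_measurable_continuous_onI continuous_on_apply_bcontfun)

lemma prim_bcontfun: "integrable leb01 v \<Longrightarrow> prim v \<in> bcontfun"
  by (rule bcontfun_normI[OF continuous_prim norm_prim_le])

lemma affine_part_bcontfun:
  assumes "integrable leb01 k" shows "affine_part k \<in> bcontfun"
proof (rule bcontfun_normI[OF _ norm_affine_part_le[OF assms]])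
  show "continuous_on UNIV (affine_part k)"
    unfolding affine_part_eq[OF assms, abs_def] by (intro continuous_intros continuous_coord)
qed

text \<open>The equation \<open>w + w'''' = f + g''\<close> with natural boundary conditions, integrated four times,
  becomes a contraction once the affine part of \<open>w\<close> is determined by making \<open>f - w\<close> orthogonal to \<open>1\<close> and \<open>x\<close>.\<close>

lemma fourth_order_problem:
  assumes f: "f \<in> L2" and g: "g \<in> L2"
  obtains w a b where "integrable leb01 w" "w \<in> borel_measurable leb01"
    "\<And>x. w x = double_prim a b (\<lambda>t. g t + prim (prim (\<lambda>s. f s - w s)) t) x"
    "(LINT x|leb01. f x - w x) = 0" "(LINT x|leb01. (f x - w x) * coord x) = 0"
proof -
  note fi = L2_integrable[OF f] and gi = L2_integrable[OF g]
  note ip = integrable_prim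
  define P4 where "P4 h = prim (prim (prim (prim h)))" for h
  define r0 where "r0 x = prim (prim g) x + P4 f x" for x
  have P4i: "integrable leb01 (P4 h)" and P4b: "P4 h \<in> bcontfun" if "integrable leb01 h" for h
    unfolding P4_def using that by (auto intro!: ip prim_bcontfun)
  have r0i: "integrable leb01 r0" and r0b: "r0 \<in> bcontfun"
    unfolding r0_def[abs_def] using fi gi by (auto intro!: P4i P4b ip plus_cont prim_bcontfun)
  \<comment> \<open>With k = f - (r0 - P4 w) one has
    \<open>f - \<Phi> w = k - affine_part k\<close>, so both moments of \<open>f - w\<close> vanish
    at a fixed point.\<close>
  define \<Phi> where "\<Phi> w x = r0 x - P4 w x + affine_part (\<lambda>t. f t - (r0 t - P4 w t)) x" for w x
  have ki: "integrable leb01 (\<lambda>t. f t - (r0 t - P4 w t))" if "integrable leb01 w" for w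
    using that fi r0i P4i by auto
  have \<Phi>b: "\<Phi> w \<in> bcontfun" if "integrable leb01 w" for w
    unfolding \<Phi>_def[abs_def]
    by (intro plus_cont minus_cont r0b P4b affine_part_bcontfun ki that)
  define F where "F w = Bcontfun (\<Phi> (apply_bcontfun w))" for w :: "real \<Rightarrow>\<^sub>C complex"
  have F: "apply_bcontfun (F w) = \<Phi> (apply_bcontfun w)" for w
    unfolding F_def by (rule Bcontfun_inverse[OF \<Phi>b[OF bcontfun_integrable]])
  \<comment> \<open>5/6 = 1/6 + 4 * 1/6: in the supremum norm \<open>P4\<close> contributes 1/6, and
    the projection applied after it at most four times as much.\<close>
  have lip: "dist (F w) (F w') \<le> 5/6 * dist w w'" for w w'
  proof (rule dist_bound)
    fix x
    define d where "d t = apply_bcontfun w t - apply_bcontfun w' t" for t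
    define A where "A = dist w w'"
    note wi = bcontfun_integrable[of w] and wi' = bcontfun_integrable[of w']
    have di: "integrable leb01 d" unfolding d_def using wi wi' by simp
    have dA: "cmod (d t) \<le> A" for t
      using dist_bounded[of w t w'] by (simp add: d_def A_def dist_norm)
    have P4d: "P4 (apply_bcontfun w) t - P4 (apply_bcontfun w') t = P4 d t" for t
      unfolding P4_def d_def[abs_def] by (simp add: prim_diff ip wi wi')
    have 1: "cmod (prim d t) \<le> A / Suc 0 * t ^ Suc 0" if "0 < t" "t < 1" for t
      by (rule norm_prim_power_le[OF di _ that]) (use dA in simp)
    have 2: "cmod (prim (prim d) t) \<le> A / Suc 0 / Suc (Suc 0) * t ^ Suc (Suc 0)" if "0 < t" "t < 1" for t
      by (rule norm_prim_power_le[OF ip[OF di] 1 that])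
    have 3: "cmod (prim (prim (prim d)) t) \<le> A / Suc 0 / Suc (Suc 0) / Suc (Suc (Suc 0)) * t ^ Suc (Suc (Suc 0))"
      if "0 < t" "t < 1" for t
      by (rule norm_prim_power_le[OF ip[OF ip[OF di]] 2 that])
    have A0: "0 \<le> A" by (simp add: A_def)
    \<comment> \<open>The power bounds hold inside (0,1), but the supremum runs over the whole line.
      So three primitives supply 1/3!, and the fourth is bounded by an L1 norm.\<close>
    have 4: "cmod (P4 d t) \<le> A / 6" for t
    proof -
      have "cmod (P4 d t) \<le> (LINT t|leb01. cmod (prim (prim (prim d)) t))"
        unfolding P4_def by (intro norm_prim_le ip di)
      also have "\<dots> \<le> (LINT t|leb01. A / 6)"
      proof (rule integral_mono)
        fix t assume "t \<in> space leb01"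
        then have t: "0 < t" "t < 1" by auto
        have "A / 6 * t ^ 3 \<le> A / 6 * 1"
          using t A0 by (intro mult_left_mono power_le_one) auto
        with 3[OF t] show "cmod (prim (prim (prim d)) t) \<le> A / 6"
          by (simp add: numeral_3_eq_3)
      qed (auto intro!: ip di)
      also have "\<dots> = A / 6" using leb01.prob_space by simp
      finally show ?thesis .
    qed
    have aff: "affine_part (\<lambda>t. f t - (r0 t - P4 (apply_bcontfun w) t)) x -
       affine_part (\<lambda>t. f t - (r0 t - P4 (apply_bcontfun w') t)) x = affine_part (P4 d) x"
    proof -
      have "(\<lambda>t. P4 d t) = (\<lambda>t. (f t - (r0 t - P4 (apply_bcontfun w) t)) - (f t - (r0 t - P4 (apply_bcontfun w') t)))"
        using P4d by (auto simp: algebra_simps)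
      then show ?thesis
        using affine_part_diff[OF ki[OF wi] ki[OF wi']] by simp
    qed
    have "apply_bcontfun (F w) x - apply_bcontfun (F w') x = affine_part (P4 d) x - P4 d x"
      unfolding F \<Phi>_def aff[symmetric] P4d[symmetric] by simp
    then have "dist (apply_bcontfun (F w) x) (apply_bcontfun (F w') x) \<le> cmod (affine_part (P4 d) x) + cmod (P4 d x)"
      by (simp add: dist_norm norm_triangle_ineq4)
    also have "cmod (affine_part (P4 d) x) \<le> 4 * (LINT t|leb01. cmod (P4 d t))"
      by (rule norm_affine_part_le[OF P4i[OF di]])
    also have "(LINT t|leb01. cmod (P4 d t)) \<le> (LINT t|leb01. A / 6)"
      by (intro integral_mono integrable_norm P4i di 4) simp
    also have "\<dots> = A / 6" using leb01.prob_space by simp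
    also note 4[of x]
    finally show "dist (apply_bcontfun (F w) x) (apply_bcontfun (F w') x) \<le> 5/6 * dist w w'"
      by (simp add: A_def)
  qed
  have "\<exists>!w. F w = w" by (rule banach_fix_type[of "5/6"]) (use lip in auto)
  then obtain w0 where "F w0 = w0" by auto
  define w where "w = apply_bcontfun w0"
  have w: "w x = \<Phi> w x" for x using \<open>F w0 = w0\<close> F[of w0] by (simp add: w_def)
  have wi: "integrable leb01 w" unfolding w_def by (rule bcontfun_integrable)
  define k where "k t = f t - (r0 t - P4 w t)" for t
  have kint: "integrable leb01 k" unfolding k_def by (rule ki[OF wi])
  define I0 I1 where "I0 = (LINT t|leb01. k t)" and "I1 = (LINT t|leb01. k t * coord t)"
  define a b where "a = 4 * I0 - 6 * I1" and "b = 12 * I1 - 6 * I0"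
  have weq: "w x = r0 x - P4 w x + (a + b * coord x)" for x
    using w[of x] affine_part_eq[OF kint, of x] by (simp add: \<Phi>_def k_def[abs_def] a_def b_def I0_def I1_def)
  have z: "f x - w x = k x - (a + b * coord x)" for x using weq[of x] by (simp add: k_def)
  have zi: "integrable leb01 (\<lambda>x. f x - w x)" using fi wi by simp
  show ?thesis
  proof (rule that[of w a b])
    show "w x = double_prim a b (\<lambda>t. g t + prim (prim (\<lambda>s. f s - w s)) t) x" for x
    proof -
      have "P4 (\<lambda>s. f s - w s) x = P4 f x - P4 w x"
        unfolding P4_def by (simp add: prim_diff ip fi wi)
      then show ?thesis
        unfolding weq[of x] by (simp add: double_prim_eq prim_add gi ip zi r0_def P4_def)
    qed
    have "(LINT x|leb01. f x - w x) = I0 - (a + b * (1/2))"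
      unfolding z using kint integrable_coord leb01.prob_space by (simp add: I0_def integral_coord)
    then show "(LINT x|leb01. f x - w x) = 0" by (simp add: a_def b_def field_simps)
    have "(LINT x|leb01. (f x - w x) * coord x) = (LINT x|leb01. k x * coord x - (a * coord x + b * (coord x * coord x)))"
      unfolding z by (simp add: algebra_simps)
    also have "\<dots> = I1 - (a * (1/2) + b * (1/3))"
      using integrable_mult_coord[OF kint] integrable_coord integrable_mult_coord[OF integrable_coord]
      by (simp add: I1_def integral_coord integral_coord_sq)
    finally show "(LINT x|leb01. (f x - w x) * coord x) = 0" by (simp add: a_def b_def field_simps)
  qed (use wi in auto)
qed

lemma prim_swap2:
  assumes "integrable leb01 z" "integrable leb01 h"
  shows "(LINT x|leb01. z x * prim (prim h) x) = (LINT x|leb01. coprim (coprim z) x * h x)"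
proof -
  have "integrable leb01 (coprim z)"
    unfolding coprim_eq[OF assms(1), abs_def] using integrable_prim[OF assms(1)] by simp
  then show ?thesis using assms by (simp add: prim_swap integrable_prim)
qed

text \<open>The two vanishing moments say that the double primitive from the left has zero value and
  slope at 1, so it coincides with the one from the right.\<close>

lemma coprim_coprim_eq_prim_prim:
  assumes z: "integrable leb01 z" and "(LINT x|leb01. z x) = 0" "(LINT x|leb01. z x * coord x) = 0"
  shows "coprim (coprim z) = prim (prim z)"
proof -
  have 1: "coprim z = (\<lambda>x. (-1) * prim z x)" using coprim_eq[OF z] assms(2) by auto
  have "(LINT x|leb01. 1 * prim z x) = (LINT t|leb01. coprim (\<lambda>_. 1) t * z t)"
    by (rule prim_swap[OF integrable_one z])
  also have "\<dots> = (LINT t|leb01. z t - z t * coord t)"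
    unfolding coprim_eq[OF integrable_one] coord_def[symmetric] using leb01.prob_space by (simp add: algebra_simps)
  also have "\<dots> = 0" using z integrable_mult_coord[OF z] assms(2,3) by simp
  finally have "(LINT x|leb01. prim z x) = 0" by simp
  then show ?thesis
    unfolding 1 using coprim_eq[of "\<lambda>x. (-1) * prim z x"] integrable_prim[OF z] prim_cmult[of "-1" "prim z"]
    by (auto simp: fun_eq_iff)
qed

text \<open>Write \<phi> as an affine function plus the double primitive of its second derivative.
  Then \<open>z = f - w\<close> kills the affine part, and the double primitive moves onto
  \<open>z\<close>, where it matches the term \<open>prim (prim z)\<close> in
  \<open>weak_deriv2 w\<close>.\<close>

lemma H2_representation:
  assumes f: "f \<in> L2" and g: "g \<in> L2"
  obtains w where "w \<in> H2" "\<And>\<phi>. \<phi> \<in> H2 \<Longrightarrow>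
     H2_inner w \<phi> = (LINT x|leb01. f x * cnj (\<phi> x)) + (LINT x|leb01. g x * cnj (weak_deriv2 \<phi> x))"
proof -
  obtain w a b where w: "integrable leb01 w" "w \<in> borel_measurable leb01"
    "\<And>x. w x = double_prim a b (\<lambda>t. g t + prim (prim (\<lambda>s. f s - w s)) t) x"
    "(LINT x|leb01. f x - w x) = 0" "(LINT x|leb01. (f x - w x) * coord x) = 0"
    using fourth_order_problem[OF f g] by blast
  define z where "z x = f x - w x" for x
  have zi: "integrable leb01 z" unfolding z_def using L2_integrable[OF f] w(1) by simp
  define v where "v t = g t + prim (prim z) t" for t
  have pz: "prim (prim z) \<in> L2" using L2_prim[OF integrable_prim[OF zi], of 0] by simp
  have v: "v \<in> L2" unfolding v_def by (intro L2_add g pz)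
  have wH: "w \<in> H2" "AE x in leb01. weak_deriv2 w x = v x"
  proof -
    have veq: "v = (\<lambda>t. g t + prim (prim (\<lambda>s. f s - w s)) t)"
      by (simp only: v_def[abs_def] z_def[abs_def])
    have "AE x in leb01. w x = double_prim a b v x"
      unfolding veq by (intro AE_I2 w(3))
    from double_prim_H2[OF v this w(2)] show "w \<in> H2" "AE x in leb01. weak_deriv2 w x = v x" .
  qed
  have z0: "(LINT x|leb01. z x) = 0" "(LINT x|leb01. z x * coord x) = 0" using w(4,5) by (auto simp: z_def)
  have wL: "w \<in> L2" by (rule H2_L2[OF wH(1)])
  have zL: "z \<in> L2" unfolding z_def by (intro L2_diff f wL)
  show ?thesis
  proof (rule that[OF wH(1)])
    fix \<phi> assume \<phi>: "\<phi> \<in> H2"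
    define h where "h x = cnj (weak_deriv2 \<phi> x)" for x
    have h: "h \<in> L2" unfolding h_def by (intro L2_cnj weak_deriv2_L2 \<phi>)
    note hi = L2_integrable[OF h]
    obtain \<alpha> \<beta> where ab: "AE x in leb01. \<phi> x = double_prim \<alpha> \<beta> (weak_deriv2 \<phi>) x"
      using H2_double_prim[OF \<phi>] by blast
    have c\<phi>: "(\<lambda>x. cnj (\<phi> x)) \<in> L2" by (intro L2_cnj H2_L2 \<phi>)
    have "(LINT x|leb01. z x * cnj (\<phi> x)) = (LINT x|leb01. cnj \<alpha> * z x + cnj \<beta> * (z x * coord x) + z x * prim (prim h) x)"
    proof (rule integral_cong_AE)
      show "AE x in leb01. z x * cnj (\<phi> x) = cnj \<alpha> * z x + cnj \<beta> * (z x * coord x) + z x * prim (prim h) x"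
        using ab
      proof eventually_elim
        case (elim x)
        then show ?case
          using coord_clamp[of x]
          by (simp add: double_prim_eq L2_integrable[OF weak_deriv2_L2[OF \<phi>]] cnj_prim h_def[abs_def] algebra_simps)
      qed
      show "(\<lambda>x. z x * cnj (\<phi> x)) \<in> borel_measurable leb01"
        by (intro borel_measurable_times L2_measurable zL c\<phi>)
      show "(\<lambda>x. cnj \<alpha> * z x + cnj \<beta> * (z x * coord x) + z x * prim (prim h) x) \<in> borel_measurable leb01"
        by (intro borel_measurable_times borel_measurable_add borel_measurable_const L2_measurable zL L2_coord measurable_prim integrable_prim hi)
    qed
    also have "\<dots> = (LINT x|leb01. z x * prim (prim h) x)"
    proof -
      have "integrable leb01 (\<lambda>x. z x * prim (prim h) x)"
        using L2_prim[OF integrable_prim[OF hi], of 0] by (intro L2_integrable_mult zL) simp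
      then show ?thesis using zi integrable_mult_coord[OF zi] z0 by simp
    qed
    also have "\<dots> = (LINT x|leb01. prim (prim z) x * h x)"
      using prim_swap2[OF zi hi] coprim_coprim_eq_prim_prim[OF zi z0] by simp
    finally have key: "(LINT x|leb01. z x * cnj (\<phi> x)) = (LINT x|leb01. prim (prim z) x * h x)" .
    have "H2_inner w \<phi> = (LINT x|leb01. w x * cnj (\<phi> x)) + (LINT x|leb01. v x * h x)"
      unfolding H2_inner_def L2_inner_def h_def
      by (intro arg_cong2[of _ _ _ _ "(+)"] refl integral_cong_AE borel_measurable_times L2_measurable
          weak_deriv2_L2 wH v L2_cnj \<phi>) (use wH(2) in \<open>auto elim: eventually_mono\<close>)
    also have "(LINT x|leb01. v x * h x) = (LINT x|leb01. g x * h x) + (LINT x|leb01. prim (prim z) x * h x)"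
      unfolding v_def distrib_right
      by (intro Bochner_Integration.integral_add L2_integrable_mult g h pz)
    also have "(LINT x|leb01. w x * cnj (\<phi> x)) + ((LINT x|leb01. g x * h x) + (LINT x|leb01. prim (prim z) x * h x))
      = ((LINT x|leb01. w x * cnj (\<phi> x)) + (LINT x|leb01. z x * cnj (\<phi> x))) + (LINT x|leb01. g x * h x)"
      unfolding key by simp
    also have "(LINT x|leb01. w x * cnj (\<phi> x)) + (LINT x|leb01. z x * cnj (\<phi> x)) = (LINT x|leb01. f x * cnj (\<phi> x))"
    proof -
      have "(LINT x|leb01. f x * cnj (\<phi> x)) = (LINT x|leb01. w x * cnj (\<phi> x) + z x * cnj (\<phi> x))"
        by (simp add: z_def algebra_simps)
      also have "\<dots> = (LINT x|leb01. w x * cnj (\<phi> x)) + (LINT x|leb01. z x * cnj (\<phi> x))"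
        by (intro Bochner_Integration.integral_add L2_integrable_mult wL zL c\<phi>)
      finally show ?thesis ..
    qed
    finally show "H2_inner w \<phi> = (LINT x|leb01. f x * cnj (\<phi> x)) + (LINT x|leb01. g x * cnj (weak_deriv2 \<phi> x))"
      by (simp add: h_def)
  qed
qed

section \<open>Consequences of \<open>T\<^sub>\<omega>(u) = 0\<close>\<close>

lemma Linf_measurable: "f \<in> Linf \<Longrightarrow> f \<in> borel_measurable leb01"
  by (simp add: Linf_def)

lemma Linf_bound:
  assumes "f \<in> Linf"
  shows "AE x in leb01. \<bar>f x\<bar> \<le> Linf_norm f" "0 \<le> Linf_norm f"
proof -
  let ?E = "esssup leb01 (\<lambda>x. ereal \<bar>f x\<bar>)"
  have ae: "AE x in leb01. ereal \<bar>f x\<bar> \<le> ?E" by (rule esssup_AE)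
  \<comment> \<open>On a null measure the essential supremum would be minus infinity, so
    nonnegativity uses that \<open>leb01\<close> has mass 1.\<close>
  have "0 \<le> ?E"
  proof (rule ccontr)
    assume neg: "\<not> 0 \<le> ?E"
    have "AE x in leb01. False"
      using ae
    proof eventually_elim
      case (elim x)
      have "0 \<le> ereal \<bar>f x\<bar>" by simp
      from order_trans[OF this elim] neg show ?case by contradiction
    qed
    then show False by simp
  qed
  moreover have "?E < \<infinity>" using assms by (simp add: Linf_def)
  ultimately obtain r where r: "?E = ereal r" "0 \<le> r" by (cases ?E) auto
  then show "0 \<le> Linf_norm f" by (simp add: Linf_norm_def)
  show "AE x in leb01. \<bar>f x\<bar> \<le> Linf_norm f"
    using ae by eventually_elim (simp add: r Linf_norm_def)
qed

lemma C1_unit_Linf: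
  assumes "q \<in> C1_unit" shows "q \<in> Linf"
proof -
  obtain q' where "\<forall>x\<in>{0..1}. (q has_real_derivative q' x) (at x within {0..1})"
    using assms unfolding C1_unit_def by blast
  then have c: "continuous_on {0..1} q"
    by (intro DERIV_continuous_on[where D=q']) blast
  then have "bounded (q ` {0..1})"
    by (intro compact_imp_bounded compact_continuous_image) auto
  then obtain B where B: "\<forall>x\<in>{0..1}. \<bar>q x\<bar> \<le> B" unfolding bounded_iff by auto
  have m: "q \<in> borel_measurable leb01"
    by (rule continuous_imp_measurable_on_sets_lebesgue) (auto intro: continuous_on_subset[OF c])
  have "esssup leb01 (\<lambda>x. ereal \<bar>q x\<bar>) \<le> ereal B"
    by (rule esssup_I) (use m B in \<open>auto intro!: AE_I2\<close>)
  then show ?thesis using m by (auto simp: Linf_def le_less_trans)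
qed

lemma L2_mult_Linf:
  assumes "f \<in> L2" "\<kappa> \<in> Linf"
  shows "(\<lambda>x. complex_of_real (\<kappa> x) * f x) \<in> L2"
  by (rule L2_mult_bounded[OF assms(1), where B="Linf_norm \<kappa>"])
     (use Linf_measurable[OF assms(2)] Linf_bound(1)[OF assms(2)] in auto)

lemma norm_double_prim_le:
  assumes v: "integrable leb01 v"
  shows "cmod (double_prim a b v x) \<le> cmod a + cmod b + (LINT t|leb01. cmod (v t))"
    "cmod (a + b * coord x) \<le> cmod a + cmod b"
    "cmod (prim (prim v) x) \<le> (LINT t|leb01. cmod (v t))"
proof -
  have "cmod (prim (prim v) x) \<le> (LINT t|leb01. cmod (prim v t))"
    by (intro norm_prim_le integrable_prim v)
  also have "\<dots> \<le> (LINT t|leb01. (LINT t|leb01. cmod (v t)))"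
    by (intro integral_mono integrable_norm integrable_prim v norm_prim_le) simp
  also have "\<dots> = (LINT t|leb01. cmod (v t))" using leb01.prob_space by simp
  finally show 1: "cmod (prim (prim v) x) \<le> (LINT t|leb01. cmod (v t))" .
  have "cmod (b * coord x) \<le> cmod b * 1"
    unfolding norm_mult by (intro mult_left_mono norm_coord_le) simp
  then show 2: "cmod (a + b * coord x) \<le> cmod a + cmod b"
    using norm_triangle_ineq[of a "b * coord x"] by simp
  show "cmod (double_prim a b v x) \<le> cmod a + cmod b + (LINT t|leb01. cmod (v t))"
    unfolding double_prim_eq[OF v]
    using norm_triangle_ineq[of "a + b * coord x" "prim (prim v) x"] 1 2 by linarith
qed

lemma double_prim_mem_H2:
  assumes "v \<in> L2"
  shows "double_prim a b v \<in> H2" "AE x in leb01. weak_deriv2 (double_prim a b v) x = v x"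
proof -
  have "double_prim a b v \<in> borel_measurable leb01"
    unfolding double_prim_def[abs_def]
    by (intro borel_measurable_add borel_measurable_const measurable_prim L2_integrable L2_prim assms)
  from double_prim_H2[OF assms _ this, of a b]
  show "double_prim a b v \<in> H2" "AE x in leb01. weak_deriv2 (double_prim a b v) x = v x" by auto
qed

text \<open>The coefficient of \<open>cnj \<phi>2\<close> in \<open>T_form\<close>, hence up to null
  sets the second component of \<open>T_op\<close>; its vanishing is the equation for
  \<open>u1\<close>.\<close>

definition residual1 :: "(real \<Rightarrow> real) \<Rightarrow> (real \<Rightarrow> real) \<Rightarrow> complex \<Rightarrow> fpair \<Rightarrow> real \<Rightarrow> complex" where
  "residual1 \<chi>1 q \<omega> u x = weak_deriv2 (fst u) x + \<omega>\<^sup>2 * complex_of_real (q x) * fst u x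
     + \<omega>\<^sup>2 * complex_of_real (\<chi>1 x) * snd u x * cnj (fst u x)"

text \<open>The part of the second integrand that is paired with \<open>\<phi>1\<close> itself; the
  rest pairs \<open>u2\<close> with the second derivative of \<open>\<phi>1\<close>.\<close>

definition lower_order2 :: "(real \<Rightarrow> real) \<Rightarrow> (real \<Rightarrow> real) \<Rightarrow> complex \<Rightarrow> fpair \<Rightarrow> real \<Rightarrow> complex" where
  "lower_order2 \<chi>2 q \<omega> u x = 4 * \<omega>\<^sup>2 * complex_of_real (q x) * snd u x
     + \<omega>\<^sup>2 * complex_of_real (\<chi>2 x) * (fst u x)\<^sup>2"

lemma H2_bounded:
  assumes "u \<in> H2"
  obtains a b where "AE x in leb01. u x = double_prim a b (weak_deriv2 u) x"
    "AE x in leb01. cmod (u x) \<le> cmod a + cmod b + (LINT t|leb01. cmod (weak_deriv2 u t))"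
proof -
  obtain a b where ab: "AE x in leb01. u x = double_prim a b (weak_deriv2 u) x"
    using H2_double_prim[OF assms] by blast
  then have "AE x in leb01. cmod (u x) \<le> cmod a + cmod b + (LINT t|leb01. cmod (weak_deriv2 u t))"
    by eventually_elim (simp add: norm_double_prim_le(1)[OF L2_integrable[OF weak_deriv2_L2[OF assms]]])
  with ab show ?thesis by (rule that)
qed

lemma coefficient_functions_L2:
  assumes u: "u \<in> X" and \<kappa>: "\<kappa> \<in> Linf" and q: "q \<in> Linf"
  shows "residual1 \<kappa> q \<omega> u \<in> L2" "lower_order2 \<kappa> q \<omega> u \<in> L2" "(\<lambda>x. complex_of_real (\<kappa> x) * (fst u x)\<^sup>2) \<in> L2"
proof -
  have H: "fst u \<in> H2" and L: "snd u \<in> L2" using u by (auto simp: X_def)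
  note L1 = H2_L2[OF H]
  obtain B where B: "AE x in leb01. cmod (fst u x) \<le> B" using H2_bounded[OF H] by metis
  have 1: "(\<lambda>x. cnj (fst u x) * snd u x) \<in> L2"
    by (rule L2_mult_bounded[OF L L2_measurable[OF L2_cnj[OF L1]], of B]) (use B in simp)
  have 2: "(\<lambda>x. fst u x * fst u x) \<in> L2"
    by (rule L2_mult_bounded[OF L1 L2_measurable[OF L1] B])
  show 3: "(\<lambda>x. complex_of_real (\<kappa> x) * (fst u x)\<^sup>2) \<in> L2"
    using L2_mult_Linf[OF 2 \<kappa>] by (simp only: power2_eq_square)
  have "(\<lambda>x. weak_deriv2 (fst u) x + \<omega>\<^sup>2 * (complex_of_real (q x) * fst u x)
     + \<omega>\<^sup>2 * (complex_of_real (\<kappa> x) * (cnj (fst u x) * snd u x))) \<in> L2"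
    by (intro L2_add L2_cmult L2_mult_Linf weak_deriv2_L2 H L1 q \<kappa> 1)
  then show "residual1 \<kappa> q \<omega> u \<in> L2"
    unfolding residual1_def[abs_def] by (simp only: ac_simps)
  have "(\<lambda>x. (4 * \<omega>\<^sup>2) * (complex_of_real (q x) * snd u x)
     + \<omega>\<^sup>2 * (complex_of_real (\<kappa> x) * (fst u x)\<^sup>2)) \<in> L2"
    by (intro L2_add L2_cmult L2_mult_Linf L q 3)
  then show "lower_order2 \<kappa> q \<omega> u \<in> L2"
    unfolding lower_order2_def[abs_def] by (simp only: ac_simps)
qed

lemma T_form_eq:
  assumes u: "u \<in> X" and \<phi>: "\<phi> \<in> X" and \<kappa>: "\<chi>1 \<in> Linf" "\<chi>2 \<in> Linf" and q: "q \<in> Linf"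
  shows "T_form \<chi>1 \<chi>2 q \<omega> u \<phi> = (LINT x|leb01. residual1 \<chi>1 q \<omega> u x * cnj (snd \<phi> x))
    + ((LINT x|leb01. lower_order2 \<chi>2 q \<omega> u x * cnj (fst \<phi> x)) + (LINT x|leb01. snd u x * cnj (weak_deriv2 (fst \<phi>) x)))"
proof -
  have H: "fst \<phi> \<in> H2" and L: "snd u \<in> L2" using u \<phi> by (auto simp: X_def)
  have "(LINT x|leb01. lower_order2 \<chi>2 q \<omega> u x * cnj (fst \<phi> x)) + (LINT x|leb01. snd u x * cnj (weak_deriv2 (fst \<phi>) x))
    = (LINT x|leb01. lower_order2 \<chi>2 q \<omega> u x * cnj (fst \<phi> x) + snd u x * cnj (weak_deriv2 (fst \<phi>) x))"
    by (intro Bochner_Integration.integral_add[symmetric] L2_integrable_mult L2_cnj weak_deriv2_L2 H2_L2 H L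
        coefficient_functions_L2 u \<kappa> q)
  then show ?thesis
    by (simp add: T_form_def case_prod_beta residual1_def lower_order2_def algebra_simps)
qed

text \<open>The choice in \<open>T_op\<close> is meaningful once one representative is exhibited:
  \<open>H2_representation\<close> supplies its first component, and \<open>residual1\<close> is its
  second.\<close>

lemma T_op_spec:
  assumes u: "u \<in> X" and \<kappa>: "\<chi>1 \<in> Linf" "\<chi>2 \<in> Linf" and q: "q \<in> Linf"
  shows "T_op \<chi>1 \<chi>2 q \<omega> u \<in> X"
    "\<And>\<phi>. \<phi> \<in> X \<Longrightarrow> X_inner (T_op \<chi>1 \<chi>2 q \<omega> u) \<phi> = T_form \<chi>1 \<chi>2 q \<omega> u \<phi>"
proof -
  have L: "snd u \<in> L2" using u by (auto simp: X_def)
  obtain w where w: "w \<in> H2" "\<And>\<phi>. \<phi> \<in> H2 \<Longrightarrow> H2_inner w \<phi> =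
    (LINT x|leb01. lower_order2 \<chi>2 q \<omega> u x * cnj (\<phi> x)) + (LINT x|leb01. snd u x * cnj (weak_deriv2 \<phi> x))"
    using H2_representation[OF coefficient_functions_L2(2)[OF u \<kappa>(2) q] L] by blast
  have "(w, residual1 \<chi>1 q \<omega> u) \<in> X \<and>
      (\<forall>\<phi>\<in>X. X_inner (w, residual1 \<chi>1 q \<omega> u) \<phi> = T_form \<chi>1 \<chi>2 q \<omega> u \<phi>)"
  proof (intro conjI ballI)
    show "(w, residual1 \<chi>1 q \<omega> u) \<in> X"
      using w(1) coefficient_functions_L2(1)[OF u \<kappa>(1) q] by (auto simp: X_def)
    fix \<phi> assume \<phi>: "\<phi> \<in> X"
    then have "fst \<phi> \<in> H2" by (auto simp: X_def)
    from w(2)[OF this] show "X_inner (w, residual1 \<chi>1 q \<omega> u) \<phi> = T_form \<chi>1 \<chi>2 q \<omega> u \<phi>"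
      unfolding T_form_eq[OF u \<phi> \<kappa> q] X_inner_def by (simp add: L2_inner_def)
  qed
  then have "T_op \<chi>1 \<chi>2 q \<omega> u \<in> X \<and> (\<forall>\<phi>\<in>X. X_inner (T_op \<chi>1 \<chi>2 q \<omega> u) \<phi> = T_form \<chi>1 \<chi>2 q \<omega> u \<phi>)"
    unfolding T_op_def by (rule someI)
  then show "T_op \<chi>1 \<chi>2 q \<omega> u \<in> X"
    "\<And>\<phi>. \<phi> \<in> X \<Longrightarrow> X_inner (T_op \<chi>1 \<chi>2 q \<omega> u) \<phi> = T_form \<chi>1 \<chi>2 q \<omega> u \<phi>" by auto
qed

lemma L2_inner_AE_zero: "AE x in leb01. f x = 0 \<Longrightarrow> L2_inner f g = 0"
  unfolding L2_inner_def by (rule integral_eq_zero_AE) (auto elim: eventually_mono)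

lemma L2_integral_cnj_self:
  assumes "f \<in> L2"
  shows "(LINT x|leb01. f x * cnj (f x)) = complex_of_real (LINT x|leb01. (cmod (f x))\<^sup>2)"
proof -
  have "(LINT x|leb01. f x * cnj (f x)) = (LINT x|leb01. complex_of_real ((cmod (f x))\<^sup>2))"
    by (simp only: complex_norm_square)
  then show ?thesis by (simp only: integral_complex_of_real)
qed

lemma L2_self_orthogonal:
  assumes "f \<in> L2" "(LINT x|leb01. f x * cnj (f x)) = 0"
  shows "AE x in leb01. f x = 0"
proof -
  have "(LINT x|leb01. (cmod (f x))\<^sup>2) = 0"
    using assms(2) unfolding L2_integral_cnj_self[OF assms(1)] by simp
  then have "AE x in leb01. (cmod (f x))\<^sup>2 = 0"
    using L2_integrable_sq[OF assms(1)] by (subst (asm) integral_nonneg_eq_0_iff_AE) auto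
  then show ?thesis by simp
qed

lemma zero_H2: "(\<lambda>x. 0) \<in> H2"
proof -
  have "double_prim 0 0 (\<lambda>_. 0) = (\<lambda>x. 0)" by (auto simp: double_prim_def prim_def)
  with double_prim_mem_H2(1)[OF L2_const[of 0], of 0 0] show ?thesis by simp
qed

lemma T_op_zero_imp:
  assumes u: "u \<in> X" and \<kappa>: "\<chi>1 \<in> Linf" "\<chi>2 \<in> Linf" and q: "q \<in> Linf"
    and zero: "X_zero (T_op \<chi>1 \<chi>2 q \<omega> u)"
  shows "AE x in leb01. residual1 \<chi>1 q \<omega> u x = 0"
    "\<And>\<phi>. \<phi> \<in> H2 \<Longrightarrow> (LINT x|leb01. lower_order2 \<chi>2 q \<omega> u x * cnj (\<phi> x))
       + (LINT x|leb01. snd u x * cnj (weak_deriv2 \<phi> x)) = 0"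
proof -
  note T = T_op_spec[OF u \<kappa> q, where \<omega>=\<omega>]
  have form: "T_form \<chi>1 \<chi>2 q \<omega> u \<phi> = 0" if \<phi>: "\<phi> \<in> X" for \<phi>
  proof -
    have z: "AE x in leb01. fst (T_op \<chi>1 \<chi>2 q \<omega> u) x = 0" "AE x in leb01. snd (T_op \<chi>1 \<chi>2 q \<omega> u) x = 0"
      using zero by (auto simp: X_zero_def)
    have "fst (T_op \<chi>1 \<chi>2 q \<omega> u) \<in> H2" using T(1) by (auto simp: X_def)
    from weak_deriv2_AE_zero[OF this z(1)] z
    have "X_inner (T_op \<chi>1 \<chi>2 q \<omega> u) \<phi> = 0"
      by (simp add: X_inner_def H2_inner_def L2_inner_AE_zero)
    with T(2)[OF \<phi>] show ?thesis by simp
  qed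
  note G = coefficient_functions_L2(1)[OF u \<kappa>(1) q, of \<omega>]
  \<comment> \<open>The residual is itself an admissible test function, which turns the first
    equation into a vanishing L2 norm.\<close>
  have X0: "((\<lambda>x. 0), residual1 \<chi>1 q \<omega> u) \<in> X" using zero_H2 G by (auto simp: X_def)
  have "AE x in leb01. weak_deriv2 (\<lambda>x. 0) x = 0" by (rule weak_deriv2_AE_zero[OF zero_H2]) simp
  then have "(LINT x|leb01. snd u x * cnj (weak_deriv2 (\<lambda>x. 0) x)) = 0"
    by (intro integral_eq_zero_AE) (auto elim: eventually_mono)
  with form[OF X0] show "AE x in leb01. residual1 \<chi>1 q \<omega> u x = 0"
    unfolding T_form_eq[OF u X0 \<kappa> q] by (intro L2_self_orthogonal G) simp
  fix \<phi> assume "\<phi> \<in> H2"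
  then have X1: "(\<phi>, (\<lambda>x. 0)) \<in> X" using L2_const by (auto simp: X_def)
  from form[OF X1] show "(LINT x|leb01. lower_order2 \<chi>2 q \<omega> u x * cnj (\<phi> x))
       + (LINT x|leb01. snd u x * cnj (weak_deriv2 \<phi> x)) = 0"
    unfolding T_form_eq[OF u X1 \<kappa> q] by simp
qed

text \<open>No derivative of \<open>v\<close> is available. Affine test functions give the two
  moments; a double primitive of any h in L2 with zero data at 0 shows, after transposition, that
  \<open>v + coprim (coprim f)\<close> is orthogonal to h, and h is then taken to be that sum.
  Together with the moments this encodes zero Cauchy data at both ends.\<close>

lemma very_weak_solution_eq:
  assumes f: "f \<in> L2" and v: "v \<in> L2"
    and eq: "\<And>\<phi>. \<phi> \<in> H2 \<Longrightarrow> (LINT x|leb01. f x * cnj (\<phi> x)) + (LINT x|leb01. v x * cnj (weak_deriv2 \<phi> x)) = 0"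
  shows "AE x in leb01. v x = - coprim (coprim f) x"
    "(LINT x|leb01. f x) = 0" "(LINT x|leb01. f x * coord x) = 0"
proof -
  have test: "(LINT x|leb01. f x * cnj (double_prim a b h x)) + (LINT x|leb01. v x * cnj (h x)) = 0"
    if h: "h \<in> L2" for a b h
  proof -
    have "(LINT x|leb01. v x * cnj (weak_deriv2 (double_prim a b h) x)) = (LINT x|leb01. v x * cnj (h x))"
      using double_prim_mem_H2[OF h, of a b]
      by (intro integral_cong_AE borel_measurable_times L2_measurable v L2_cnj weak_deriv2_L2 h)
         (auto elim: eventually_mono)
    with eq[OF double_prim_mem_H2(1)[OF h, of a b]] show ?thesis by simp
  qed
  have prim0: "prim (\<lambda>x. 0) = (\<lambda>x. 0)" by (auto simp: prim_def)
  note fi = L2_integrable[OF f]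
  show "(LINT x|leb01. f x) = 0"
    using test[OF L2_const[of 0], of 1 0] by (simp add: double_prim_def prim0)
  have "double_prim 0 1 (\<lambda>x. 0) = coord" by (auto simp: double_prim_def prim0 coord_def)
  moreover have "cnj (coord x) = coord x" for x by (simp add: coord_clamp)
  ultimately show "(LINT x|leb01. f x * coord x) = 0"
    using test[OF L2_const[of 0], of 0 1] by simp
  have c: "coprim f = (\<lambda>x. (LINT x|leb01. f x) - prim f x)" using coprim_eq[OF fi] by auto
  have ci: "integrable leb01 (coprim f)" unfolding c using integrable_prim[OF fi] by simp
  have cc: "coprim (coprim f) \<in> L2"
  proof -
    have "(\<lambda>x. (LINT x|leb01. coprim f x) - (0 + prim (coprim f) x)) \<in> L2"
      by (intro L2_diff L2_const L2_prim ci)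
    also have "(\<lambda>x. (LINT x|leb01. coprim f x) - (0 + prim (coprim f) x)) = coprim (coprim f)"
      using coprim_eq[OF ci] by auto
    finally show ?thesis .
  qed
  define h where "h x = v x + coprim (coprim f) x" for x
  have h: "h \<in> L2" unfolding h_def by (intro L2_add v cc)
  note ch = L2_cnj[OF h]
  have "(LINT x|leb01. h x * cnj (h x)) = (LINT x|leb01. v x * cnj (h x)) + (LINT x|leb01. coprim (coprim f) x * cnj (h x))"
    unfolding h_def distrib_right
    by (rule Bochner_Integration.integral_add) (use L2_integrable_mult[OF v ch] L2_integrable_mult[OF cc ch] in \<open>auto simp: h_def\<close>)
  also have "(LINT x|leb01. coprim (coprim f) x * cnj (h x)) = (LINT x|leb01. f x * prim (prim (\<lambda>x. cnj (h x))) x)"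
    by (rule prim_swap2[OF fi L2_integrable[OF ch], symmetric])
  also have "prim (prim (\<lambda>x. cnj (h x))) = (\<lambda>x. cnj (double_prim 0 0 h x))"
    unfolding double_prim_def by (simp add: cnj_prim)
  also have "(LINT x|leb01. v x * cnj (h x)) + (LINT x|leb01. f x * cnj (double_prim 0 0 h x)) = 0"
    using test[OF h, of 0 0] by (simp add: add.commute)
  finally have "AE x in leb01. h x = 0" by (rule L2_self_orthogonal[OF h])
  then show "AE x in leb01. v x = - coprim (coprim f) x"
    by eventually_elim (simp add: h_def add_eq_0_iff2)
qed

lemma norm_coprim_coprim_le:
  assumes f: "integrable leb01 f"
  shows "cmod (coprim (coprim f) x) \<le> (LINT t|leb01. cmod (f t))"
proof -
  have c: "coprim f = (\<lambda>x. (LINT x|leb01. f x) - prim f x)" using coprim_eq[OF f] by auto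
  have ci: "integrable leb01 (coprim f)" unfolding c using integrable_prim[OF f] by simp
  have "cmod (coprim (coprim f) x) \<le> (LINT t|leb01. cmod (coprim f t))" by (rule norm_coprim_le[OF ci])
  also have "\<dots> \<le> (LINT t|leb01. (LINT t|leb01. cmod (f t)))"
    by (intro integral_mono integrable_norm ci norm_coprim_le f) simp
  also have "\<dots> = (LINT t|leb01. cmod (f t))" using leb01.prob_space by simp
  finally show ?thesis .
qed

section \<open>Moments of squares of affine functions\<close>

text \<open>Otherwise \<open>r = a / b\<close> is a common root of two real quadratics. Eliminating \<open>r\<^sup>2\<close> leaves a linear
  equation, which makes \<open>r\<close> real; but the first quadratic has negative discriminant.\<close>

lemma quadratic_moments_nondegenerate:
  fixes a b :: complex and m0 m1 m2 m3 :: real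
  assumes m0: "m0 > 0" and D: "m0 * m2 - m1\<^sup>2 > 0"
    and 0: "m0 * a\<^sup>2 + 2 * m1 * a * b + m2 * b\<^sup>2 = 0"
    and 1: "m1 * a\<^sup>2 + 2 * m2 * a * b + m3 * b\<^sup>2 = 0"
  shows "a = 0 \<and> b = 0"
proof (cases "b = 0")
  case True
  with 0 m0 show ?thesis by simp
next
  case False
  define r where "r = a / b"
  have a: "a = r * b" using False by (simp add: r_def)
  have "(m0 * r\<^sup>2 + 2 * m1 * r + m2) * b\<^sup>2 = 0" using 0 unfolding a by (simp add: algebra_simps power2_eq_square)
  then have r0: "m0 * r\<^sup>2 + 2 * m1 * r + m2 = 0" using False by simp
  have "(m1 * r\<^sup>2 + 2 * m2 * r + m3) * b\<^sup>2 = 0" using 1 unfolding a by (simp add: algebra_simps power2_eq_square)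
  then have r1: "m1 * r\<^sup>2 + 2 * m2 * r + m3 = 0" using False by simp
  have "m0 * (m1 * r\<^sup>2 + 2 * m2 * r + m3) - m1 * (m0 * r\<^sup>2 + 2 * m1 * r + m2) = 0" unfolding r0 r1 by simp
  then have "complex_of_real (2 * (m0 * m2 - m1\<^sup>2)) * r = complex_of_real (m1 * m2 - m0 * m3)"
    by (simp add: algebra_simps power2_eq_square)
  then have "r = complex_of_real (m1 * m2 - m0 * m3) / complex_of_real (2 * (m0 * m2 - m1\<^sup>2))"
    using D by (simp add: nonzero_eq_divide_eq mult.commute del: of_real_mult of_real_diff)
  then obtain s where s: "r = complex_of_real s" by (metis of_real_divide)
  have "complex_of_real (m0 * s\<^sup>2 + 2 * m1 * s + m2) = 0" using r0 by (simp add: s)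
  then have "m0 * s\<^sup>2 + 2 * m1 * s + m2 = 0" by (simp only: of_real_eq_0_iff)
  then have "m0 * (m0 * s\<^sup>2 + 2 * m1 * s + m2) = 0" by simp
  then have "(m0 * s + m1)\<^sup>2 + (m0 * m2 - m1\<^sup>2) = 0" by (simp add: algebra_simps power2_eq_square)
  with D zero_le_power2[of "m0 * s + m1"] show ?thesis by linarith
qed

text \<open>Both forms are homogeneous of degree 2, so the minimum over the compact sphere |a| + |b|
  = 1 is a suitable constant; \<open>quadratic_moments_nondegenerate\<close> keeps it away from
  0.\<close>

lemma quadratic_moments_lower_bound:
  fixes m0 m1 m2 m3 :: real
  assumes "m0 > 0" "m0 * m2 - m1\<^sup>2 > 0"
  obtains c where "c > 0" "\<And>(a::complex) (b::complex). c * (cmod a + cmod b)\<^sup>2 \<le>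
    cmod (m0 * a\<^sup>2 + 2 * m1 * a * b + m2 * b\<^sup>2) + cmod (m1 * a\<^sup>2 + 2 * m2 * a * b + m3 * b\<^sup>2)"
proof -
  define F :: "complex \<Rightarrow> complex \<Rightarrow> real" where "F a b = cmod (m0 * a\<^sup>2 + 2 * m1 * a * b + m2 * b\<^sup>2)
    + cmod (m1 * a\<^sup>2 + 2 * m2 * a * b + m3 * b\<^sup>2)" for a b :: complex
  define S where "S = {p :: complex \<times> complex. cmod (fst p) + cmod (snd p) = 1}"
  have "bounded S"
    unfolding bounded_iff
  proof (intro exI ballI)
    fix p assume "p \<in> S"
    then show "norm p \<le> 1"
      using norm_Pair_le[of "fst p" "snd p"] by (simp add: S_def)
  qed
  moreover have "closed S" unfolding S_def by (intro closed_Collect_eq continuous_intros)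
  ultimately have "compact S" by (simp add: compact_eq_bounded_closed)
  moreover have "(1, 0) \<in> S" by (simp add: S_def)
  then have "S \<noteq> {}" by auto
  moreover have "continuous_on S (\<lambda>p. F (fst p) (snd p))"
    unfolding F_def by (intro continuous_intros)
  ultimately have "\<exists>p\<in>S. \<forall>x\<in>S. F (fst p) (snd p) \<le> F (fst x) (snd x)"
    by (rule continuous_attains_inf)
  then obtain p where p: "p \<in> S" "\<And>x. x \<in> S \<Longrightarrow> F (fst p) (snd p) \<le> F (fst x) (snd x)"
    by blast
  define c where "c = F (fst p) (snd p)"
  have "c \<noteq> 0"
  proof
    assume "c = 0"
    then have "m0 * (fst p)\<^sup>2 + 2 * m1 * fst p * snd p + m2 * (snd p)\<^sup>2 = 0"
        "m1 * (fst p)\<^sup>2 + 2 * m2 * fst p * snd p + m3 * (snd p)\<^sup>2 = 0"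
      by (simp_all add: c_def F_def add_nonneg_eq_0_iff)
    from quadratic_moments_nondegenerate[OF assms this] p(1) show False by (simp add: S_def)
  qed
  then have "c > 0" by (simp add: c_def F_def less_le)
  moreover have "c * (cmod a + cmod b)\<^sup>2 \<le> F a b" for a b
  proof (cases "cmod a + cmod b = 0")
    case True
    then show ?thesis by (simp add: F_def)
  next
    case False
    define N where "N = cmod a + cmod b"
    have N: "N > 0" using False by (simp add: N_def less_le)
    have ab: "a = N * (a / N)" "b = N * (b / N)" using N by auto
    have "cmod a / N + cmod b / N = 1"
      using N by (simp add: add_divide_distrib[symmetric]) (simp add: N_def)
    then have "(a / N, b / N) \<in> S" using N by (simp add: S_def norm_divide)
    from p(2)[OF this] have "c \<le> F (a / N) (b / N)" by (simp add: c_def)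
    moreover have "F (N * x) (N * y) = N\<^sup>2 * F x y" for x y :: complex
    proof -
      have "m0 * (N * x)\<^sup>2 + 2 * m1 * (N * x) * (N * y) + m2 * (N * y)\<^sup>2
          = complex_of_real (N\<^sup>2) * (m0 * x\<^sup>2 + 2 * m1 * x * y + m2 * y\<^sup>2)"
        "m1 * (N * x)\<^sup>2 + 2 * m2 * (N * x) * (N * y) + m3 * (N * y)\<^sup>2
          = complex_of_real (N\<^sup>2) * (m1 * x\<^sup>2 + 2 * m2 * x * y + m3 * y\<^sup>2)"
        by (simp_all add: algebra_simps power2_eq_square)
      then show ?thesis
        unfolding F_def by (simp only: norm_mult norm_of_real) (simp add: distrib_left)
    qed
    from this[of "a / N" "b / N"] have "F a b = N\<^sup>2 * F (a / N) (b / N)" using ab by simp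
    ultimately show ?thesis
      unfolding N_def[symmetric] by (simp add: mult.commute[of c] mult_left_mono)
  qed
  ultimately show ?thesis unfolding F_def by (rule that)
qed

lemma Linf_mult_integrable:
  fixes g :: "real \<Rightarrow> real"
  assumes \<kappa>: "\<kappa> \<in> Linf" and g: "integrable leb01 g"
  shows "integrable leb01 (\<lambda>x. \<kappa> x * g x)"
proof (rule Bochner_Integration.integrable_bound)
  show "integrable leb01 (\<lambda>x. Linf_norm \<kappa> * norm (g x))" using g by simp
  show "(\<lambda>x. \<kappa> x * g x) \<in> borel_measurable leb01"
    using Linf_measurable[OF \<kappa>] borel_measurable_integrable[OF g]
    by (intro borel_measurable_times)
  show "AE x in leb01. norm (\<kappa> x * g x) \<le> norm (Linf_norm \<kappa> * norm (g x))"
    using Linf_bound(1)[OF \<kappa>]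
    by eventually_elim (simp add: abs_mult mult_right_mono Linf_bound(2)[OF \<kappa>])
qed

text \<open>Expanding the squares yields the forms of \<open>quadratic_moments_lower_bound\<close>,
  with the moments of \<kappa> as coefficients.\<close>

lemma weighted_affine_square_lower_bound:
  assumes \<kappa>: "\<kappa> \<in> Linf" and pos: "AE x in leb01. \<kappa> x > 0"
  obtains c where "c > 0" "\<And>(a::complex) (b::complex). c * (cmod a + cmod b)\<^sup>2 \<le>
     cmod (LINT x|leb01. complex_of_real (\<kappa> x) * (a + b * coord x)\<^sup>2) +
     cmod (LINT x|leb01. complex_of_real (\<kappa> x) * (a + b * coord x)\<^sup>2 * coord x)"
proof -
  define m where "m n = (LINT x|leb01. \<kappa> x * x ^ n)" for n
  have int: "integrable leb01 (\<lambda>x. \<kappa> x * x ^ n)" for n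
    using Linf_mult_integrable[OF \<kappa> integrable_power[of n]] by simp
  have intc: "integrable leb01 (\<lambda>x. complex_of_real (\<kappa> x * x ^ n))" for n
    using int by (simp only: complex_of_real_integrable_eq)
  have mc: "complex_of_real (m n) = (LINT x|leb01. complex_of_real (\<kappa> x * x ^ n))" for n
    unfolding m_def by (rule integral_complex_of_real[symmetric])
  have positive: "(LINT x|leb01. \<kappa> x * g x) > 0"
    if i: "integrable leb01 (\<lambda>x. \<kappa> x * g x)" and g: "\<And>x. g x \<ge> 0" "AE x in leb01. g x \<noteq> 0" for g
  proof -
    have nn: "AE x in leb01. 0 \<le> \<kappa> x * g x" using pos by eventually_elim (simp add: g)
    have "(LINT x|leb01. \<kappa> x * g x) \<noteq> 0"
    proof
      assume "(LINT x|leb01. \<kappa> x * g x) = 0"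
      then have "AE x in leb01. \<kappa> x * g x = 0" using i nn by (subst (asm) integral_nonneg_eq_0_iff_AE)
      with pos g(2) have "AE x in leb01. False" by eventually_elim auto
      then show False by simp
    qed
    moreover have "0 \<le> (LINT x|leb01. \<kappa> x * g x)" by (rule integral_nonneg_AE[OF nn])
    ultimately show ?thesis by simp
  qed
  have m0: "m 0 > 0" using positive[of "\<lambda>_. 1"] int[of 0] by (simp add: m_def)
  \<comment> \<open>The integral equals m0 (m0 m2 - m1^2), and the square vanishes only at m1 / m0;
    its positivity is therefore the determinant condition.\<close>
  have expand: "(LINT x|leb01. \<kappa> x * (m 0 * x - m 1)\<^sup>2) = (m 0)\<^sup>2 * m 2 - 2 * m 0 * m 1 * m 1 + (m 1)\<^sup>2 * m 0"
    and iexpand: "integrable leb01 (\<lambda>x. \<kappa> x * (m 0 * x - m 1)\<^sup>2)"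
  proof -
    have eq: "(\<lambda>x. \<kappa> x * (m 0 * x - m 1)\<^sup>2) =
       (\<lambda>x. (m 0)\<^sup>2 * (\<kappa> x * x ^ 2) - (2 * m 0 * m 1) * (\<kappa> x * x ^ 1) + (m 1)\<^sup>2 * (\<kappa> x * x ^ 0))"
      by (auto simp: power2_eq_square algebra_simps)
    show "integrable leb01 (\<lambda>x. \<kappa> x * (m 0 * x - m 1)\<^sup>2)"
      unfolding eq by (intro Bochner_Integration.integrable_add Bochner_Integration.integrable_diff integrable_mult_right int)
    have "(LINT x|leb01. \<kappa> x * (m 0 * x - m 1)\<^sup>2) =
      (LINT x|leb01. (m 0)\<^sup>2 * (\<kappa> x * x ^ 2) - (2 * m 0 * m 1) * (\<kappa> x * x ^ 1)) + (LINT x|leb01. (m 1)\<^sup>2 * (\<kappa> x * x ^ 0))"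
      unfolding eq by (intro Bochner_Integration.integral_add Bochner_Integration.integrable_diff integrable_mult_right int)
    also have "(LINT x|leb01. (m 0)\<^sup>2 * (\<kappa> x * x ^ 2) - (2 * m 0 * m 1) * (\<kappa> x * x ^ 1))
       = (LINT x|leb01. (m 0)\<^sup>2 * (\<kappa> x * x ^ 2)) - (LINT x|leb01. (2 * m 0 * m 1) * (\<kappa> x * x ^ 1))"
      by (intro Bochner_Integration.integral_diff integrable_mult_right int)
    finally show "(LINT x|leb01. \<kappa> x * (m 0 * x - m 1)\<^sup>2) = (m 0)\<^sup>2 * m 2 - 2 * m 0 * m 1 * m 1 + (m 1)\<^sup>2 * m 0"
      by (simp only: integral_mult_right_zero m_def)
  qed
  have "(LINT x|leb01. \<kappa> x * (m 0 * x - m 1)\<^sup>2) > 0"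
  proof (rule positive[OF iexpand])
    show "AE x in leb01. (m 0 * x - m 1)\<^sup>2 \<noteq> 0"
      using AE_leb01_neq[of "m 1 / m 0"] by eventually_elim (use m0 in \<open>auto simp: field_simps\<close>)
  qed simp
  then have "m 0 * (m 0 * m 2 - (m 1)\<^sup>2) > 0" unfolding expand by (simp add: algebra_simps power2_eq_square)
  then have D: "m 0 * m 2 - (m 1)\<^sup>2 > 0" using m0 by (simp add: zero_less_mult_iff)
  have poly: "(LINT x|leb01. complex_of_real (\<kappa> x) * (a + b * coord x)\<^sup>2 * coord x ^ n)
     = m n * a\<^sup>2 + 2 * m (Suc n) * a * b + m (Suc (Suc n)) * b\<^sup>2" for a b :: complex and n
  proof -
    have "(LINT x|leb01. complex_of_real (\<kappa> x) * (a + b * coord x)\<^sup>2 * coord x ^ n) =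
      (LINT x|leb01. a\<^sup>2 * complex_of_real (\<kappa> x * x ^ n) + (2 * a * b) * complex_of_real (\<kappa> x * x ^ Suc n)
        + b\<^sup>2 * complex_of_real (\<kappa> x * x ^ Suc (Suc n)))"
      by (intro Bochner_Integration.integral_cong) (auto simp: coord_eq power2_eq_square algebra_simps)
    also have "\<dots> = (LINT x|leb01. a\<^sup>2 * complex_of_real (\<kappa> x * x ^ n) + (2 * a * b) * complex_of_real (\<kappa> x * x ^ Suc n))
        + (LINT x|leb01. b\<^sup>2 * complex_of_real (\<kappa> x * x ^ Suc (Suc n)))"
      by (intro Bochner_Integration.integral_add Bochner_Integration.integrable_add integrable_mult_right intc)
    also have "(LINT x|leb01. a\<^sup>2 * complex_of_real (\<kappa> x * x ^ n) + (2 * a * b) * complex_of_real (\<kappa> x * x ^ Suc n))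
        = (LINT x|leb01. a\<^sup>2 * complex_of_real (\<kappa> x * x ^ n)) + (LINT x|leb01. (2 * a * b) * complex_of_real (\<kappa> x * x ^ Suc n))"
      by (intro Bochner_Integration.integral_add integrable_mult_right intc)
    finally show ?thesis
      unfolding integral_mult_right_zero mc[symmetric] by (simp add: mult_ac)
  qed
  obtain c where c: "c > 0" "\<And>(a::complex) (b::complex). c * (cmod a + cmod b)\<^sup>2 \<le>
    cmod (m 0 * a\<^sup>2 + 2 * m 1 * a * b + m 2 * b\<^sup>2) + cmod (m 1 * a\<^sup>2 + 2 * m 2 * a * b + m 3 * b\<^sup>2)"
    using quadratic_moments_lower_bound[OF m0 D, of "m 3"] by metis
  show ?thesis
  proof (rule that[OF c(1)])
    fix a b :: complex
    show "c * (cmod a + cmod b)\<^sup>2 \<le>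
     cmod (LINT x|leb01. complex_of_real (\<kappa> x) * (a + b * coord x)\<^sup>2) +
     cmod (LINT x|leb01. complex_of_real (\<kappa> x) * (a + b * coord x)\<^sup>2 * coord x)"
      using c(2)[of a b] poly[of a b 0] poly[of a b 1] by (simp add: numeral_2_eq_2 numeral_3_eq_3)
  qed
qed

section \<open>Bounds in terms of the norm of X\<close>

lemma affine_coefficients_le:
  "cmod a + cmod b \<le> 28 * (LINT x|leb01. cmod (a + b * coord x))"
proof -
  let ?L = "LINT x|leb01. cmod (a + b * coord x)"
  have i: "integrable leb01 (\<lambda>x. a + b * coord x)" using integrable_coord by simp
  have "(LINT x|leb01. a + b * coord x) = a + b * (1/2)"
    using integrable_coord leb01.prob_space by (simp add: integral_coord)
  then have 0: "cmod (a + b * (1/2)) \<le> ?L" using integral_norm_bound[of leb01 "\<lambda>x. a + b * coord x"] by simp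
  have "(LINT x|leb01. (a + b * coord x) * coord x) = (LINT x|leb01. a * coord x + b * (coord x * coord x))"
    by (simp add: algebra_simps)
  also have "\<dots> = a * (1/2) + b * (1/3)"
    using integrable_coord integrable_mult_coord[OF integrable_coord] by (simp add: integral_coord integral_coord_sq)
  finally have "cmod (a * (1/2) + b * (1/3)) = cmod (LINT x|leb01. (a + b * coord x) * coord x)" by simp
  also have "\<dots> \<le> (LINT x|leb01. cmod ((a + b * coord x) * coord x))" by (rule integral_norm_bound)
  also have "\<dots> \<le> ?L"
  proof (rule integral_mono)
    show "cmod ((a + b * coord x) * coord x) \<le> cmod (a + b * coord x)" for x
      unfolding norm_mult by (rule mult_left_le[OF norm_coord_le]) simp
  qed (intro integrable_norm integrable_mult_coord i)+
  finally have 1: "cmod (a * (1/2) + b * (1/3)) \<le> ?L" .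
  \<comment> \<open>The inverse Gram matrix recovers the coefficients from the moments; this gives
    28 = (4 + 6) + (12 + 6).\<close>
  have "a = 4 * (a + b * (1/2)) - 6 * (a * (1/2) + b * (1/3))" by (simp add: algebra_simps)
  then have "cmod a \<le> 4 * cmod (a + b * (1/2)) + 6 * cmod (a * (1/2) + b * (1/3))"
    using norm_triangle_ineq4[of "4 * (a + b * (1/2))" "6 * (a * (1/2) + b * (1/3))"] by (simp only: norm_mult norm_numeral)
  moreover have "b = 12 * (a * (1/2) + b * (1/3)) - 6 * (a + b * (1/2))" by (simp add: algebra_simps)
  then have "cmod b \<le> 12 * cmod (a * (1/2) + b * (1/3)) + 6 * cmod (a + b * (1/2))"
    using norm_triangle_ineq4[of "12 * (a * (1/2) + b * (1/3))" "6 * (a + b * (1/2))"] by (simp only: norm_mult norm_numeral)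
  ultimately show ?thesis using 0 1 by linarith
qed

lemma X_norm_bounds:
  assumes u: "u \<in> X"
  shows "(LINT x|leb01. cmod (fst u x)) \<le> X_norm u"
    "(LINT x|leb01. cmod (weak_deriv2 (fst u) x)) \<le> X_norm u" "0 \<le> X_norm u"
proof -
  have H: "fst u \<in> H2" and L: "snd u \<in> L2" using u by (auto simp: X_def)
  note L1 = H2_L2[OF H] and L2 = weak_deriv2_L2[OF H]
  have N: "X_norm u = sqrt ((LINT x|leb01. (cmod (fst u x))\<^sup>2) + (LINT x|leb01. (cmod (weak_deriv2 (fst u) x))\<^sup>2)
      + (LINT x|leb01. (cmod (snd u x))\<^sup>2))"
    unfolding X_norm_def X_inner_def H2_inner_def L2_inner_def
      L2_integral_cnj_self[OF L1] L2_integral_cnj_self[OF L2] L2_integral_cnj_self[OF L] by simp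
  have nn: "0 \<le> (LINT x|leb01. (cmod (f x))\<^sup>2)" for f :: "real \<Rightarrow> complex" by simp
  show "(LINT x|leb01. cmod (fst u x)) \<le> X_norm u"
    unfolding N by (rule order_trans[OF L2_integral_norm_le[OF L1]]) (use nn in \<open>simp add: add_nonneg_nonneg add.assoc\<close>)
  show "(LINT x|leb01. cmod (weak_deriv2 (fst u) x)) \<le> X_norm u"
    unfolding N by (rule order_trans[OF L2_integral_norm_le[OF L2]]) (use nn in \<open>simp add: add_nonneg_nonneg add.assoc\<close>)
  show "0 \<le> X_norm u" unfolding N using nn by (simp add: add_nonneg_nonneg)
qed

text \<open>57 = 28 * 2 + 1: the affine part is \<open>fst u\<close> minus a double primitive, so
  its L1 norm is at most \<open>2 * X_norm u\<close>; the integral of the second derivative adds one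
  more.\<close>

lemma sup_bound_le_X_norm:
  assumes u: "u \<in> X" and ab: "AE x in leb01. fst u x = double_prim a b (weak_deriv2 (fst u)) x"
  shows "cmod a + cmod b + (LINT x|leb01. cmod (weak_deriv2 (fst u) x)) \<le> 57 * X_norm u"
proof -
  let ?v = "weak_deriv2 (fst u)"
  have H: "fst u \<in> H2" using u by (auto simp: X_def)
  have v: "integrable leb01 ?v" by (intro L2_integrable weak_deriv2_L2 H)
  have f: "integrable leb01 (fst u)" by (intro L2_integrable H2_L2 H)
  have "(LINT x|leb01. cmod (a + b * coord x)) \<le> (LINT x|leb01. cmod (fst u x) + (LINT t|leb01. cmod (?v t)))"
  proof (rule integral_mono_AE)
    show "AE x in leb01. cmod (a + b * coord x) \<le> cmod (fst u x) + (LINT t|leb01. cmod (?v t))"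
      using ab
    proof eventually_elim
      case (elim x)
      then have "a + b * coord x = fst u x - prim (prim ?v) x" by (simp add: double_prim_eq[OF v])
      then show ?case
        using norm_triangle_ineq4[of "fst u x" "prim (prim ?v) x"] norm_double_prim_le(3)[OF v, of x] by simp
    qed
  qed (use f integrable_coord in auto)
  also have "\<dots> = (LINT x|leb01. cmod (fst u x)) + (LINT t|leb01. cmod (?v t))"
    using f leb01.prob_space by simp
  finally show ?thesis
    using X_norm_bounds[OF u] affine_coefficients_le[of a b] by linarith
qed

section \<open>The main estimate\<close>

lemma Linf_norm_pos:
  assumes "\<kappa> \<in> Linf" "AE x in leb01. \<kappa> x > 0"
  shows "Linf_norm \<kappa> > 0"
proof (rule ccontr)
  assume *: "\<not> Linf_norm \<kappa> > 0"
  have "AE x in leb01. False"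
    using Linf_bound(1)[OF assms(1)] assms(2) by eventually_elim (use * in linarith)
  then show False by simp
qed

text \<open>\<open>S\<close> bounds \<open>u1\<close>, and \<open>\<delta> * S\<close> bounds its
  second derivative; the summands of \<delta> come from \<open>q * u1\<close> and from
  \<open>\<chi>1 * u2 * cnj u1\<close>. In the third bound the first term is the moment of
  \<open>\<chi>2 * u1^2\<close>, the second the cost of replacing \<open>u1\<close> by its affine
  part.\<close>

lemma T_op_zero_estimates:
  assumes u: "u \<in> X" and \<chi>: "\<chi>1 \<in> Linf" "\<chi>2 \<in> Linf" and q: "q \<in> Linf"
    and zero: "X_zero (T_op \<chi>1 \<chi>2 q \<omega> u)" and k: "k = (cmod \<omega>)\<^sup>2" "k > 0"
    and small: "8 * k * Linf_norm q \<le> 1"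
    and ab: "AE x in leb01. fst u x = double_prim a b (weak_deriv2 (fst u)) x"
    and S: "S = cmod a + cmod b + (LINT x|leb01. cmod (weak_deriv2 (fst u) x))"
    and M: "M = Linf_norm \<chi>1 + Linf_norm \<chi>2"
    and \<delta>: "\<delta> = k * Linf_norm q + 2 * (k * M * S)\<^sup>2"
  shows "AE x in leb01. cmod (snd u x) \<le> 2 * k * Linf_norm \<chi>2 * S\<^sup>2"
    and "(LINT x|leb01. cmod (weak_deriv2 (fst u) x)) \<le> \<delta> * S"
    and "\<And>\<phi>. \<phi> = (\<lambda>_. 1) \<or> \<phi> = coord \<Longrightarrow> cmod (LINT x|leb01. complex_of_real (\<chi>2 x) * (a + b * coord x)\<^sup>2 * \<phi> x)
         \<le> 8 * k * Linf_norm q * Linf_norm \<chi>2 * S\<^sup>2 + 2 * Linf_norm \<chi>2 * \<delta> * S\<^sup>2"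
proof -
  let ?v = "weak_deriv2 (fst u)" and ?F = "lower_order2 \<chi>2 q \<omega> u"
  let ?u1 = "fst u" and ?u2 = "snd u" and ?Q = "Linf_norm q" and ?\<mu> = "Linf_norm \<chi>2"
  define W where "W = (LINT x|leb01. cmod (?v x))"
  define E where "E = (LINT x|leb01. cmod (?F x))"
  have H: "?u1 \<in> H2" and u2: "?u2 \<in> L2" using u by (auto simp: X_def)
  have v: "integrable leb01 ?v" by (intro L2_integrable weak_deriv2_L2 H)
  have F: "?F \<in> L2" by (rule coefficient_functions_L2(2)[OF u \<chi>(2) q])
  have W0: "0 \<le> W" unfolding W_def by simp
  have SW: "S = cmod a + cmod b + W" by (simp add: S W_def)
  then have S0: "0 \<le> S" using W0 by simp
  note Q0 = Linf_bound(2)[OF q] and \<mu>0 = Linf_bound(2)[OF \<chi>(2)] and n0 = Linf_bound(2)[OF \<chi>(1)]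
  have kw: "cmod (\<omega>\<^sup>2) = k" by (simp add: k(1) norm_power)
  have u1S: "AE x in leb01. cmod (?u1 x) \<le> S"
    using ab by eventually_elim (simp add: S norm_double_prim_le(1)[OF v])
  note eqs = T_op_zero_imp[OF u \<chi> q zero]
  have sol: "AE x in leb01. ?u2 x = - coprim (coprim ?F) x"
    "(LINT x|leb01. ?F x) = 0" "(LINT x|leb01. ?F x * coord x) = 0"
    by (rule very_weak_solution_eq[OF F u2 eqs(2)], assumption)+
  have u2E: "AE x in leb01. cmod (?u2 x) \<le> E"
    using sol(1) by eventually_elim (simp add: E_def norm_coprim_coprim_le[OF L2_integrable[OF F]])
  have u2i: "integrable leb01 (\<lambda>x. cmod (?u2 x))" by (intro integrable_norm L2_integrable u2)
  have "(LINT x|leb01. cmod (?u2 x)) \<le> (LINT x|leb01. E)"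
    by (rule integral_mono_AE[OF u2i _ u2E]) simp
  then have V: "(LINT x|leb01. cmod (?u2 x)) \<le> E" using leb01.prob_space by simp
  have "E \<le> (LINT x|leb01. 4 * k * ?Q * cmod (?u2 x) + k * ?\<mu> * S\<^sup>2)"
    unfolding E_def
  proof (rule integral_mono_AE)
    show "integrable leb01 (\<lambda>x. cmod (?F x))" by (intro integrable_norm L2_integrable F)
    show "integrable leb01 (\<lambda>x. 4 * k * ?Q * cmod (?u2 x) + k * ?\<mu> * S\<^sup>2)" using u2i by simp
    show "AE x in leb01. cmod (?F x) \<le> 4 * k * ?Q * cmod (?u2 x) + k * ?\<mu> * S\<^sup>2"
      using u1S Linf_bound(1)[OF q] Linf_bound(1)[OF \<chi>(2)]
    proof eventually_elim
      case (elim x)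
      have "cmod (?F x) \<le> 4 * k * \<bar>q x\<bar> * cmod (?u2 x) + k * \<bar>\<chi>2 x\<bar> * (cmod (?u1 x))\<^sup>2"
        unfolding lower_order2_def by (rule order_trans[OF norm_triangle_ineq]) (simp add: norm_mult norm_power k(1))
      also have "\<dots> \<le> 4 * k * ?Q * cmod (?u2 x) + k * ?\<mu> * S\<^sup>2"
        using elim k(2) Q0 \<mu>0 by (intro add_mono mult_mono power_mono) auto
      finally show ?case .
    qed
  qed
  also have "\<dots> = 4 * k * ?Q * (LINT x|leb01. cmod (?u2 x)) + k * ?\<mu> * S\<^sup>2"
    using u2i leb01.prob_space by simp
  also have "\<dots> \<le> 4 * k * ?Q * E + k * ?\<mu> * S\<^sup>2"
    using V k(2) Q0 by (intro add_right_mono mult_left_mono) auto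
  finally have E1: "E \<le> 4 * k * ?Q * E + k * ?\<mu> * S\<^sup>2" .
  have E0: "0 \<le> E" by (simp add: E_def)
  \<comment> \<open>Absorption: the smallness condition makes 4 k Q E at most E / 2.\<close>
  have "8 * k * ?Q * E \<le> 1 * E" by (rule mult_right_mono[OF small E0])
  with E1 have E2: "E \<le> 2 * k * ?\<mu> * S\<^sup>2" by simp
  show "AE x in leb01. cmod (?u2 x) \<le> 2 * k * ?\<mu> * S\<^sup>2"
    using u2E by eventually_elim (use E2 in linarith)

  have EM: "E \<le> 2 * k * M * S\<^sup>2"
    by (rule order_trans[OF E2]) (use k(2) n0 M in \<open>auto intro!: mult_right_mono mult_left_mono\<close>)
  have "AE x in leb01. cmod (?v x) \<le> \<delta> * S"
    using eqs(1) u1S u2E Linf_bound(1)[OF q] Linf_bound(1)[OF \<chi>(1)]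
  proof eventually_elim
    case (elim x)
    from elim(1) have "?v x = - (\<omega>\<^sup>2 * complex_of_real (q x) * ?u1 x + \<omega>\<^sup>2 * complex_of_real (\<chi>1 x) * ?u2 x * cnj (?u1 x))"
      by (simp only: residual1_def add.assoc eq_neg_iff_add_eq_0)
    then have "cmod (?v x) = cmod (\<omega>\<^sup>2 * complex_of_real (q x) * ?u1 x + \<omega>\<^sup>2 * complex_of_real (\<chi>1 x) * ?u2 x * cnj (?u1 x))"
      by (simp only: norm_minus_cancel)
    also have "\<dots> \<le> k * \<bar>q x\<bar> * cmod (?u1 x) + k * \<bar>\<chi>1 x\<bar> * cmod (?u2 x) * cmod (?u1 x)"
      by (rule order_trans[OF norm_triangle_ineq]) (simp add: norm_mult norm_power k(1))
    also have "\<dots> \<le> k * ?Q * S + k * Linf_norm \<chi>1 * E * S"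
      using elim k(2) Q0 n0 E0 by (intro add_mono mult_mono) auto
    also have "\<dots> \<le> k * ?Q * S + k * M * (2 * k * M * S\<^sup>2) * S"
      using k(2) n0 \<mu>0 E0 S0 EM M by (intro add_mono mult_mono order_refl) auto
    also have "\<dots> = \<delta> * S" by (simp add: \<delta> power2_eq_square algebra_simps)
    finally show ?case .
  qed
  then have "W \<le> (LINT x|leb01. \<delta> * S)"
    unfolding W_def using v by (intro integral_mono_AE) auto
  then have W\<delta>: "W \<le> \<delta> * S" using leb01.prob_space by simp
  then show "(LINT x|leb01. cmod (?v x)) \<le> \<delta> * S" by (simp add: W_def)

  fix \<phi> :: "real \<Rightarrow> complex" assume "\<phi> = (\<lambda>_. 1) \<or> \<phi> = coord"
  then have \<phi>: "\<phi> \<in> L2" "\<And>x. cmod (\<phi> x) \<le> 1" "(LINT x|leb01. ?F x * \<phi> x) = 0"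
    using sol(2,3) L2_coord L2_const norm_coord_le by auto
  have Lq: "(\<lambda>x. complex_of_real (q x) * ?u2 x) \<in> L2" by (rule L2_mult_Linf[OF u2 q])
  have Lu: "(\<lambda>x. complex_of_real (\<chi>2 x) * (?u1 x)\<^sup>2) \<in> L2" by (rule coefficient_functions_L2(3)[OF u \<chi>(2) q])
  have Ll: "(\<lambda>x. complex_of_real (\<chi>2 x) * (a + b * coord x)\<^sup>2) \<in> L2"
  proof (rule L2_mult_Linf[OF _ \<chi>(2)], rule L2_bounded)
    show "AE x in leb01. cmod ((a + b * coord x)\<^sup>2) \<le> (cmod a + cmod b)\<^sup>2"
      unfolding norm_power by (intro AE_I2 power_mono norm_double_prim_le(2)[OF v]) simp
  qed (intro borel_measurable_power borel_measurable_add borel_measurable_times borel_measurable_const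
      L2_measurable L2_coord)
  let ?A = "LINT x|leb01. complex_of_real (q x) * ?u2 x * \<phi> x"
  let ?B = "LINT x|leb01. complex_of_real (\<chi>2 x) * (?u1 x)\<^sup>2 * \<phi> x"
  let ?C = "LINT x|leb01. complex_of_real (\<chi>2 x) * (a + b * coord x)\<^sup>2 * \<phi> x"
  \<comment> \<open>Dividing the moment identity by \<omega>^2 leaves the moment of
    \<open>\<chi>2 * u1^2\<close> equal to -4 times that of \<open>q * u2\<close>, which is small
    because \<open>u2\<close> carries a factor k.\<close>
  have "(LINT x|leb01. ?F x * \<phi> x) = (LINT x|leb01. 4 * \<omega>\<^sup>2 * (complex_of_real (q x) * ?u2 x * \<phi> x)
     + \<omega>\<^sup>2 * (complex_of_real (\<chi>2 x) * (?u1 x)\<^sup>2 * \<phi> x))"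
    by (intro Bochner_Integration.integral_cong refl) (simp add: lower_order2_def algebra_simps)
  also have "\<dots> = 4 * \<omega>\<^sup>2 * ?A + \<omega>\<^sup>2 * ?B"
    using L2_integrable_mult[OF Lq \<phi>(1)] L2_integrable_mult[OF Lu \<phi>(1)] by simp
  finally have "\<omega>\<^sup>2 * (4 * ?A + ?B) = 0" using \<phi>(3) by (simp add: algebra_simps)
  moreover have "\<omega>\<^sup>2 \<noteq> 0" using k by auto
  ultimately have "?B = - (4 * ?A)" by (simp add: eq_neg_iff_add_eq_0 add.commute)
  then have B: "cmod ?B = 4 * cmod ?A" by (simp only: norm_minus_cancel norm_mult norm_numeral)
  have "cmod ?A \<le> (LINT x|leb01. cmod (complex_of_real (q x) * ?u2 x * \<phi> x))" by (rule integral_norm_bound)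
  also have "\<dots> \<le> (LINT x|leb01. ?Q * E)"
  proof (rule integral_mono_AE)
    show "AE x in leb01. cmod (complex_of_real (q x) * ?u2 x * \<phi> x) \<le> ?Q * E"
      using u2E Linf_bound(1)[OF q]
    proof eventually_elim
      case (elim x)
      have "cmod (complex_of_real (q x) * ?u2 x * \<phi> x) = \<bar>q x\<bar> * cmod (?u2 x) * cmod (\<phi> x)"
        by (simp add: norm_mult)
      also have "\<dots> \<le> ?Q * E * 1" using elim Q0 E0 \<phi>(2)[of x] by (intro mult_mono) auto
      finally show ?case by simp
    qed
  qed (intro integrable_norm L2_integrable_mult Lq \<phi>(1), simp)
  finally have A: "cmod ?A \<le> ?Q * E" using leb01.prob_space by simp
  \<comment> \<open>A difference of squares: one factor is at most \<open>\<delta> * S\<close>, the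
    other at most \<open>2 * S\<close>.\<close>
  have "?C - ?B = (LINT x|leb01. complex_of_real (\<chi>2 x) * (a + b * coord x)\<^sup>2 * \<phi> x - complex_of_real (\<chi>2 x) * (?u1 x)\<^sup>2 * \<phi> x)"
    by (intro Bochner_Integration.integral_diff[symmetric] L2_integrable_mult Lu Ll \<phi>(1))
  then have "cmod (?C - ?B) \<le> (LINT x|leb01. cmod (complex_of_real (\<chi>2 x) * (a + b * coord x)\<^sup>2 * \<phi> x - complex_of_real (\<chi>2 x) * (?u1 x)\<^sup>2 * \<phi> x))"
    by (simp only: integral_norm_bound)
  also have "\<dots> \<le> (LINT x|leb01. ?\<mu> * (\<delta> * S * (2 * S)))"
  proof (rule integral_mono_AE)
    show "AE x in leb01. cmod (complex_of_real (\<chi>2 x) * (a + b * coord x)\<^sup>2 * \<phi> x - complex_of_real (\<chi>2 x) * (?u1 x)\<^sup>2 * \<phi> x)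
       \<le> ?\<mu> * (\<delta> * S * (2 * S))"
      using ab u1S Linf_bound(1)[OF \<chi>(2)]
    proof eventually_elim
      case (elim x)
      have "a + b * coord x - ?u1 x = - prim (prim ?v) x" using elim(1) by (simp add: double_prim_eq[OF v])
      then have 1: "cmod (a + b * coord x - ?u1 x) \<le> \<delta> * S"
        using norm_double_prim_le(3)[OF v, of x] W\<delta> by (simp add: W_def)
      have 2: "cmod (a + b * coord x + ?u1 x) \<le> 2 * S"
        using norm_triangle_ineq[of "a + b * coord x" "?u1 x"] norm_double_prim_le(2)[OF v, of a b x] elim(2) SW W0
        by linarith
      have "cmod (complex_of_real (\<chi>2 x) * (a + b * coord x)\<^sup>2 * \<phi> x - complex_of_real (\<chi>2 x) * (?u1 x)\<^sup>2 * \<phi> x)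
        = cmod (complex_of_real (\<chi>2 x) * ((a + b * coord x - ?u1 x) * (a + b * coord x + ?u1 x)) * \<phi> x)"
        by (simp add: power2_eq_square algebra_simps)
      also have "\<dots> = \<bar>\<chi>2 x\<bar> * (cmod (a + b * coord x - ?u1 x) * cmod (a + b * coord x + ?u1 x)) * cmod (\<phi> x)"
        by (simp add: norm_mult)
      also have "\<dots> \<le> ?\<mu> * (\<delta> * S * (2 * S)) * 1"
        using elim(3) 1 2 \<phi>(2)[of x] \<mu>0 S0 order_trans[OF W0 W\<delta>]
        by (intro mult_mono) auto
      finally show ?case by simp
    qed
  qed (intro integrable_norm Bochner_Integration.integrable_diff L2_integrable_mult Lu Ll \<phi>(1), simp)
  finally have CB: "cmod (?C - ?B) \<le> 2 * ?\<mu> * \<delta> * S\<^sup>2"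
    using leb01.prob_space by (simp add: power2_eq_square mult_ac)
  have "?Q * E \<le> ?Q * (2 * k * ?\<mu> * S\<^sup>2)" by (rule mult_left_mono[OF E2 Q0])
  then have "cmod ?B \<le> 8 * k * ?Q * ?\<mu> * S\<^sup>2" using A B by (simp add: mult_ac)
  with CB norm_triangle_ineq2[of ?C ?B]
  show "cmod ?C \<le> 8 * k * ?Q * ?\<mu> * S\<^sup>2 + 2 * ?\<mu> * \<delta> * S\<^sup>2" by linarith
qed

text \<open>The threshold multiplied out is k M + k M^2 N <= c. Then \<open>\<mu> \<le> M\<close>
  puts \<mu> into the denominators, and \<open>c \<le> \<mu>\<^sup>2\<close> bounds (c / \<mu>)^2 by
  c, so that the second bound is linear in c. Here 6498 = 2 * 57^2.\<close>

lemma small_frequency_bounds: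
  fixes k c M N \<mu> Q S :: real
  assumes "0 < \<mu>" "\<mu> \<le> M" "0 \<le> N" "0 \<le> Q" "0 < k" "0 \<le> S" "S \<le> 57 * N" "0 < c" "c \<le> \<mu>\<^sup>2"
    and k: "k \<le> c / (M * (1 + M * N))"
  shows "k * M \<le> c" "k * Q + 2 * (k * M * S)\<^sup>2 \<le> c * (Q / \<mu> + 6498)"
proof -
  have M: "M > 0" using assms by linarith
  have MN: "0 \<le> M * N" using M assms by simp
  have "k * (M * (1 + M * N)) \<le> c"
    using k M MN by (simp add: pos_le_divide_eq add_pos_nonneg)
  then have sum: "k * M + (k * M * N) * M \<le> c" by (simp add: algebra_simps)
  moreover have "0 \<le> k * M * N * M" using M assms by simp
  ultimately show kM: "k * M \<le> c" by linarith
  have "0 \<le> k * M" using M assms by simp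
  with sum have "(k * M * N) * M \<le> c" by linarith
  moreover have "(k * M * N) * \<mu> \<le> (k * M * N) * M" using M assms by (intro mult_left_mono) auto
  ultimately have kMN: "k * M * N \<le> c / \<mu>" using assms(1) by (simp add: pos_le_divide_eq)
  have "k * M * S \<le> k * M * (57 * N)" using M assms by (intro mult_left_mono) auto
  with kMN have "k * M * S \<le> 57 * (c / \<mu>)" by simp
  moreover have "0 \<le> k * M * S" using M assms by simp
  ultimately have "(k * M * S)\<^sup>2 \<le> (57 * (c / \<mu>))\<^sup>2" by (intro power_mono)
  also have "\<dots> = 3249 * (c * (c / \<mu>\<^sup>2))" by (simp add: power2_eq_square)
  also have "\<dots> \<le> 3249 * (c * 1)" using assms by (intro mult_left_mono) auto
  finally have 1: "(k * M * S)\<^sup>2 \<le> 3249 * c" by simp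
  have "k * \<mu> \<le> k * M" using assms by (intro mult_left_mono) auto
  with kM have "k \<le> c / \<mu>" using assms(1) by (simp add: pos_le_divide_eq)
  then have "k * Q \<le> c / \<mu> * Q" using assms by (intro mult_right_mono) auto
  with 1 show "k * Q + 2 * (k * M * S)\<^sup>2 \<le> c * (Q / \<mu> + 6498)" by (simp add: algebra_simps)
qed

theorem theorem2p4:
  fixes \<chi>2 :: "real \<Rightarrow> real" and Q :: real
  assumes "\<chi>2 \<in> Linf" and "AE x in leb01. \<chi>2 x > 0" and "Q > 0"
  shows "\<exists>c>0. \<forall>\<chi>1\<in>Linf. \<forall>q\<in>C1_unit. \<forall>M. \<forall>u\<in>X. \<forall>\<omega>.
           Linf_norm q = Q \<longrightarrow> M = Linf_norm \<chi>1 + Linf_norm \<chi>2 \<longrightarrow>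
           \<not> X_zero u \<longrightarrow>
           0 < (cmod \<omega>)\<^sup>2 \<longrightarrow> (cmod \<omega>)\<^sup>2 \<le> c / (M * (1 + M * X_norm u)) \<longrightarrow>
           \<not> X_zero (T_op \<chi>1 \<chi>2 q \<omega> u)"
proof -
  define \<mu> where "\<mu> = Linf_norm \<chi>2"
  have \<mu>: "\<mu> > 0" unfolding \<mu>_def by (rule Linf_norm_pos[OF assms(1,2)])
  obtain c0 where c0: "c0 > 0" "\<And>(a::complex) (b::complex). c0 * (cmod a + cmod b)\<^sup>2 \<le>
     cmod (LINT x|leb01. complex_of_real (\<chi>2 x) * (a + b * coord x)\<^sup>2) +
     cmod (LINT x|leb01. complex_of_real (\<chi>2 x) * (a + b * coord x)\<^sup>2 * coord x)"
    using weighted_affine_square_lower_bound[OF assms(1,2)] by blast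
  define D where "D = Q / \<mu> + 6498"
  have D: "D > 0" using \<mu> assms(3) by (simp add: D_def add_pos_pos)
  \<comment> \<open>Each of the two moments contributes 8 k Q \<mu> + 2 \<mu> \<delta> in units of
    S^2; with k \<mu> <= c and \<delta> <= c D their sum is at most c K.\<close>
  define K where "K = 16 * Q + 4 * \<mu> * D"
  have K: "K > 0" using \<mu> assms(3) D by (simp add: K_def add_pos_pos)
  \<comment> \<open>\<mu>^2 serves \<open>small_frequency_bounds\<close>; 1 / (8 D) makes \<delta>
    at most 1/8 and hence 8 k Q at most 1; c0 / (8 K) produces the factor 1/2 at the end.\<close>
  define c where "c = Min {\<mu>\<^sup>2, 1 / (8 * D), 1 / (2 * D), c0 / (8 * K)}"
  have c: "c > 0" using \<mu> D K c0(1) by (simp add: c_def)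
  have c_le: "c \<le> \<mu>\<^sup>2" "c \<le> 1 / (8 * D)" "c \<le> c0 / (8 * K)"
    by (simp_all add: c_def)
  have cD: "c * D \<le> 1 / 8" and cK: "c * K \<le> c0 / 8"
    using c_le(2,3) D K by (simp_all add: field_simps)
  show ?thesis
  proof (intro exI[of _ c] conjI c ballI allI impI notI)
    fix \<chi>1 q M u \<omega>
    assume \<chi>1: "\<chi>1 \<in> Linf" and q: "q \<in> C1_unit" and u: "u \<in> X" and Q: "Linf_norm q = Q"
      and M: "M = Linf_norm \<chi>1 + Linf_norm \<chi>2" and nz: "\<not> X_zero u" and k0: "0 < (cmod \<omega>)\<^sup>2"
      and kle: "(cmod \<omega>)\<^sup>2 \<le> c / (M * (1 + M * X_norm u))"
      and zero: "X_zero (T_op \<chi>1 \<chi>2 q \<omega> u)"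
    note qL = C1_unit_Linf[OF q]
    have H: "fst u \<in> H2" using u by (auto simp: X_def)
    obtain a b where ab: "AE x in leb01. fst u x = double_prim a b (weak_deriv2 (fst u)) x"
      using H2_double_prim[OF H] by blast
    define k where "k = (cmod \<omega>)\<^sup>2"
    define W where "W = (LINT x|leb01. cmod (weak_deriv2 (fst u) x))"
    define S where "S = cmod a + cmod b + W"
    define \<delta> where "\<delta> = k * Q + 2 * (k * M * S)\<^sup>2"
    have W0: "0 \<le> W" by (simp add: W_def)
    have S0: "0 \<le> S" using W0 by (simp add: S_def)
    have \<mu>M: "\<mu> \<le> M" using Linf_bound(2)[OF \<chi>1] by (simp add: M \<mu>_def)
    have k: "k > 0" using k0 by (simp add: k_def)
    have S57: "S \<le> 57 * X_norm u" using sup_bound_le_X_norm[OF u ab] by (simp add: S_def W_def)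
    have bounds: "k * M \<le> c" "\<delta> \<le> c * D"
      using small_frequency_bounds[OF \<mu> \<mu>M X_norm_bounds(3)[OF u] less_imp_le[OF assms(3)] k S0 S57 c c_le(1)] kle
      by (simp_all add: k_def \<delta>_def D_def)
    have "k * Q \<le> \<delta>" by (simp add: \<delta>_def)
    then have small: "8 * k * Linf_norm q \<le> 1" using bounds(2) cD Q by simp
    note est = T_op_zero_estimates[OF u \<chi>1 assms(1) qL zero k_def k small ab S_def[unfolded W_def] M \<delta>_def[folded Q]]
    have "W \<le> \<delta> * S" using est(2) by (simp add: W_def)
    also have "\<dots> \<le> 1/8 * S" using bounds(2) cD S0 by (intro mult_right_mono) auto
    \<comment> \<open>At most an eighth of S comes from the second derivative, so the affine
      coefficients carry at least half of it.\<close>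
    finally have "S \<le> 2 * (cmod a + cmod b)" using S0 by (simp add: S_def)
    from power_mono[OF this S0, of 2] have "S\<^sup>2 \<le> 4 * (cmod a + cmod b)\<^sup>2"
      unfolding power_mult_distrib by simp
    then have "c0 * S\<^sup>2 \<le> c0 * (4 * (cmod a + cmod b)\<^sup>2)"
      using c0(1) by (intro mult_left_mono) auto
    also have "\<dots> = 4 * (c0 * (cmod a + cmod b)\<^sup>2)" by simp
    also have "\<dots> \<le> 4 * (2 * (8 * k * Q * \<mu> * S\<^sup>2 + 2 * \<mu> * \<delta> * S\<^sup>2))"
      using c0(2)[of a b] est(3)[of "\<lambda>_. 1"] est(3)[of coord] by (simp add: Q \<mu>_def)
    also have "\<dots> = 4 * (16 * Q * (k * \<mu>) + 4 * \<mu> * \<delta>) * S\<^sup>2" by (simp add: algebra_simps)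
    also have "\<dots> \<le> 4 * (16 * Q * c + 4 * \<mu> * (c * D)) * S\<^sup>2"
    proof (intro mult_right_mono mult_left_mono add_mono)
      have "k * \<mu> \<le> k * M" using k \<mu>M by (intro mult_left_mono) auto
      with bounds(1) show "k * \<mu> \<le> c" by linarith
    qed (use bounds(2) \<mu> assms(3) in auto)
    also have "\<dots> = 4 * (c * K) * S\<^sup>2" by (simp add: K_def algebra_simps)
    also have "\<dots> \<le> 4 * (c0 / 8) * S\<^sup>2" using cK by (intro mult_right_mono mult_left_mono) auto
    \<comment> \<open>The chain bounds c0 S^2 by half of itself.\<close>
    finally have "c0 * S\<^sup>2 \<le> 0" by simp
    then have "S = 0" using c0(1) by (simp add: mult_le_0_iff)
    then have "AE x in leb01. snd u x = 0" using est(1) by simp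
    moreover have "AE x in leb01. fst u x = 0"
    proof -
      have v: "integrable leb01 (weak_deriv2 (fst u))" by (intro L2_integrable weak_deriv2_L2 H)
      show ?thesis
        using ab
      proof eventually_elim
        case (elim x)
        then show ?case
          using norm_double_prim_le(1)[OF v, of a b x] \<open>S = 0\<close> by (simp add: S_def W_def)
      qed
    qed
    ultimately show False using nz by (simp add: X_zero_def)
  qed
qed

end
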